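(* Let $(X,\mathsf{d},\mu)$ be a compact uniformly locally doubling metric measure space. For any integer $k\ge 2$, there exists $r_k>0$ such that for any $r\in(0,r_k)$, the operator $-\tilde{\Delta}_r$ admits $k+1$ eigenvalues $$0=\lambda_0(-\tilde{\Delta}_r)<\lambda_1(-\tilde{\Delta}_r)\le\ldots\le\lambda_k(-\tilde{\Delta}_r)$$ such that $\lambda_i(-\tilde{\Delta}_r)=\tilde{\lambda}_{i,r}$ for any $i\in\{0,\ldots,k\}$.
   Context: A metric measure space is a triple $(X,\mathsf{d},\mu)$ where $(X,\mathsf{d})$ is a metric space and $\mu$ is a fully supported regular Borel measure such that $V(x,r):=\mu(B_r(x))<+\infty$ for all $x\in X$, $r>0$, where $B_r(x)=\{y\in X:\mathsf{d}(x,y)<r\}$. It is uniformly locally doubling if there exist $C,r_0>0$ such that $V(x,2r)\le C\,V(x,r)$ for all $x\in X$ and $r\in(0,r_0)$. The symmetrized AMV (Asymptotic Mean Value) $r$-Laplace operator $\tilde{\Delta}_r$, acting on $L^2(X,\mu)$, is defined for $f\in L^2(X,\mu)$ and $\mu$-a.e. $x\in X$ by $$\tilde{\Delta}_r f(x)=\frac{1}{2r^2}\,\frac{1}{V(x,r)}\int_{B_r(x)}\left(1+\frac{V(x,r)}{V(y,r)}\right)(f(y)-f(x))\,d\mu(y).$$ Its energy functional is $$\tilde{E}_r(f)=\frac14\int_X\int_X 1_{B_r(x)}(y)\left(\frac1{V(x,r)}+\frac1{V(y,r)}\right)\left(\frac{f(x)-f(y)}{r}\right)^2d\mu(y)\,d\mu(x).$$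 For $k\in\mathbb{N}=\{0,1,2,\ldots\}$, $$\tilde{\lambda}_{k,r}=\inf_{V}\ \sup_{f\in V\setminus\{0\}}\frac{\tilde{E}_r(f)}{\|f\|_{2}^2},$$ the infimum being over all $(k+1)$-dimensional linear subspaces $V$ of $L^2(X,\mu)$.
   Formalization: X is assumed infinite or to have at least k+1 points (otherwise L^2 has dimension below k+1), and 0 < λ_1 is claimed only for connected X (for disconnected compact X, λ_1 = 0 for all small r); all else is claimed for every such X. *)

theory Defs
  imports "HOL-Analysis.Analysis"
begin

section \<open>Metric measure spaces\<close>

text \<open>The metric space is the type \<open>'a\<close> itself; a measure on it carries its Borel sets.\<close>

definition regular_borel :: "'a::metric_space measure \<Rightarrow> bool" where
  "regular_borel M \<longleftrightarrow>
     sets M = sets borel \<and>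
     (\<forall>A\<in>sets M.
        emeasure M A = (INF U\<in>{U. open U \<and> A \<subseteq> U}. emeasure M U) \<and>
        emeasure M A = (SUP K\<in>{K. compact K \<and> K \<subseteq> A}. emeasure M K))"

definition fully_supported :: "'a::metric_space measure \<Rightarrow> bool" where
  "fully_supported M \<longleftrightarrow> (\<forall>x. \<forall>r>0. emeasure M (ball x r) > 0)"

definition metric_measure_space :: "'a::metric_space measure \<Rightarrow> bool" where
  "metric_measure_space M \<longleftrightarrow>
     regular_borel M \<and> fully_supported M \<and> (\<forall>x. \<forall>r>0. emeasure M (ball x r) < \<infinity>)"

abbreviation vol :: "'a::metric_space measure \<Rightarrow> 'a \<Rightarrow> real \<Rightarrow> real" where
  "vol M x r \<equiv> measure M (ball x r)"

definition uniformly_locally_doubling :: "'a::metric_space measure \<Rightarrow> bool" where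
  "uniformly_locally_doubling M \<longleftrightarrow>
     (\<exists>C>0. \<exists>r0>0. \<forall>x. \<forall>r\<in>{0<..<r0}. vol M x (2 * r) \<le> C * vol M x r)"

section \<open>The real Hilbert space of square-integrable functions\<close>

text \<open>
  Elements are represented by functions, and equality is equality almost everywhere.
  A linear subspace is represented by the set of all representatives of its elements,
  that is, by its preimage under the quotient map; this is why subspaces are required
  to be closed under almost-everywhere equality.
\<close>

definition L2 :: "'a measure \<Rightarrow> ('a \<Rightarrow> real) set" where
  "L2 M = {f \<in> borel_measurable M. integrable M (\<lambda>x. (f x)\<^sup>2)}"

definition L2_norm_sq :: "'a measure \<Rightarrow> ('a \<Rightarrow> real) \<Rightarrow> real" where
  "L2_norm_sq M f = (\<integral>x. (f x)\<^sup>2 \<partial>M)"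

definition L2_zero :: "'a measure \<Rightarrow> ('a \<Rightarrow> real) set" where
  "L2_zero M = {f \<in> L2 M. AE x in M. f x = 0}"

definition L2_subspace :: "'a measure \<Rightarrow> ('a \<Rightarrow> real) set \<Rightarrow> bool" where
  "L2_subspace M V \<longleftrightarrow>
     V \<subseteq> L2 M \<and> (\<lambda>x. 0) \<in> V \<and>
     (\<forall>f\<in>V. \<forall>g\<in>V. (\<lambda>x. f x + g x) \<in> V) \<and>
     (\<forall>c. \<forall>f\<in>V. (\<lambda>x. c * f x) \<in> V) \<and>
     (\<forall>f\<in>V. \<forall>g\<in>L2 M. (AE x in M. f x = g x) \<longrightarrow> g \<in> V)"

definition L2_independent :: "'a measure \<Rightarrow> nat \<Rightarrow> (nat \<Rightarrow> 'a \<Rightarrow> real) \<Rightarrow> bool" where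
  "L2_independent M n b \<longleftrightarrow>
     (\<forall>c::nat \<Rightarrow> real. (AE x in M. (\<Sum>i<n. c i * b i x) = 0) \<longrightarrow> (\<forall>i<n. c i = 0))"

definition L2_has_dim :: "'a measure \<Rightarrow> ('a \<Rightarrow> real) set \<Rightarrow> nat \<Rightarrow> bool" where
  "L2_has_dim M V n \<longleftrightarrow>
     (\<exists>b. (\<forall>i<n. b i \<in> V) \<and> L2_independent M n b \<and>
          (\<forall>f\<in>V. \<exists>c::nat \<Rightarrow> real. AE x in M. f x = (\<Sum>i<n. c i * b i x)))"

definition L2_eigenfunction ::
    "'a measure \<Rightarrow> (('a \<Rightarrow> real) \<Rightarrow> 'a \<Rightarrow> real) \<Rightarrow> real \<Rightarrow> ('a \<Rightarrow> real) \<Rightarrow> bool" where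
  "L2_eigenfunction M T l f \<longleftrightarrow> f \<in> L2 M - L2_zero M \<and> (AE x in M. T f x = l * f x)"

text \<open>
  The numbers \<open>l 0, \<dots>, l (n - 1)\<close> are eigenvalues of \<open>T\<close>, counted with multiplicity: a value
  occurring \<open>m\<close> times in the list has an eigenspace of dimension at least \<open>m\<close>.
\<close>

definition L2_eigenvalues ::
    "'a measure \<Rightarrow> (('a \<Rightarrow> real) \<Rightarrow> 'a \<Rightarrow> real) \<Rightarrow> nat \<Rightarrow> (nat \<Rightarrow> real) \<Rightarrow> bool" where
  "L2_eigenvalues M T n l \<longleftrightarrow>
     (\<exists>\<phi>. (\<forall>i<n. L2_eigenfunction M T (l i) (\<phi> i)) \<and> L2_independent M n \<phi>)"

section \<open>The symmetrized AMV operator, its energy and its min-max values\<close>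

definition sym_amv_laplace :: "'a::metric_space measure \<Rightarrow> real \<Rightarrow> ('a \<Rightarrow> real) \<Rightarrow> 'a \<Rightarrow> real" where
  "sym_amv_laplace M r f x =
     1 / (2 * r\<^sup>2) * (1 / vol M x r) *
     (LINT y:ball x r|M. (1 + vol M x r / vol M y r) * (f y - f x))"

definition sym_amv_energy :: "'a::metric_space measure \<Rightarrow> real \<Rightarrow> ('a \<Rightarrow> real) \<Rightarrow> ennreal" where
  "sym_amv_energy M r f =
     ennreal (1 / 4) *
     (\<integral>\<^sup>+x. \<integral>\<^sup>+y. ennreal (indicator (ball x r) y * (1 / vol M x r + 1 / vol M y r) *
                        ((f x - f y) / r)\<^sup>2) \<partial>M \<partial>M)"

definition sym_amv_minmax :: "'a::metric_space measure \<Rightarrow> nat \<Rightarrow> real \<Rightarrow> ennreal" where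
  "sym_amv_minmax M k r =
     (INF V\<in>{V. L2_subspace M V \<and> L2_has_dim M V (k + 1)}.
        SUP f\<in>V - L2_zero M. sym_amv_energy M r f / ennreal (L2_norm_sq M f))"

end

theory Submission
  imports Defs "HOL-Complex_Analysis.Great_Picard"
begin

text \<open>
  With \<open>k(x,y) = 1\<^bsub>d(x,y)<r\<^esub> (1/V(x,r) + 1/V(y,r))\<close>, the operator \<open>- 2 r\<^sup>2 \<Delta>\<close> is \<open>T f = a f - K f\<close>, where \<open>K\<close> is the
  integral operator with kernel \<open>k\<close> and \<open>a = K 1 \<ge> 1\<close>. Since \<open>k\<close> is bounded, \<open>K\<close> is compact: a bounded
  sequence has a subsequence whose integrals over all open sets converge, and then \<open>K\<close> of it converges
  pointwise and boundedly. Below the level \<open>1\<close> the spectrum of \<open>T\<close> is therefore obtained by minimising the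
  quadratic form successively on orthogonal complements of the previous minimisers. Lipschitz bumps
  around \<open>k + 1\<close> distinct points span a space on which the form is at most a constant times \<open>r\<^sup>2\<close> times
  the squared norm, so for small \<open>r\<close> the first \<open>k + 1\<close> min-max values lie below that level. If the form
  of \<open>f\<close> vanishes, then \<open>f\<close> is almost everywhere constant on balls of radius \<open>r\<close>, hence almost everywhere
  constant when the space is connected; this makes the second eigenvalue positive.
\<close>

section \<open>Square-integrable functions\<close>

text \<open>The multiplier \<open>a\<close> is only known to lie above 1, so minimising sequences at
  or above that level may fail to converge; this is why \<open>r\<close> must be small before
  \<open>k + 1\<close> eigenvalues can be expected. Three points need care. First,
  \<open>K f x\<close> involves a ball around every point \<open>x\<close>, hence uncountably many
  integrals, while a diagonal argument handles only countably many; open sets are therefore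
  exhausted by finite unions of rational balls, with an error that is uniform along the sequence.
  Second, the summand \<open>1/V(y,r)\<close> of the kernel varies with the integration variable, so
  a subsequence must work for \<open>f\<close> and for \<open>f/V\<close> at once. Third, the
  pointwise bound on \<open>a\<close> depends on \<open>r\<close>, but the integral of
  \<open>a\<close> is exactly twice the total mass. This keeps the energy bound for Lipschitz
  functions free of \<open>r\<close>-dependent constants. Operator and energy turn out to carry the
  same factor \<open>1/(2 r^2)\<close> relative to \<open>T\<close> and its form, so critical points
  of the form and min-max values agree without further normalisation.\<close>

lemma nonneg_quadratic_imp_discriminant_le:
  fixes p q s :: real
  assumes "\<And>t. 0 \<le> p + 2 * t * q + t\<^sup>2 * s"
  shows "q\<^sup>2 \<le> p * s"
proof -
  have p: "0 \<le> p" using assms[of 0] by simp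
  show ?thesis
  proof (cases "s = 0")
    case True
    have "q = 0"
    proof (rule ccontr)
      assume "q \<noteq> 0"
      \<comment> \<open>With \<open>s = 0\<close> the expression is affine in \<open>t\<close>, and
        this choice gives it the value -1.\<close>
      then show False
        using assms[of "- (p + 1) / (2 * q)"] True p by (simp add: field_simps)
    qed
    with True show ?thesis by simp
  next
    case False
    have s: "0 < s"
    proof (rule ccontr)
      assume "\<not> 0 < s"
      with False have neg: "s < 0" by simp
      \<comment> \<open>Here \<open>t >= 1\<close> and \<open>t * s = s - (p + 1)\<close>, so the
        quadratic term is at most \<open>- (p + 1)\<close>. Whichever of \<open>t\<close>,
        \<open>-t\<close> makes the linear term nonpositive then gives a negative value.\<close>
      define t where "t = (1 - (p + 1) / s)"
      have t1: "t \<ge> 1" and ts: "t * s \<le> - (p + 1)"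
        using neg p by (auto simp: t_def field_simps)
      have "t\<^sup>2 * s \<le> t * s" using t1 neg
        by (simp add: power2_eq_square mult_right_mono_neg)
      then have "t\<^sup>2 * s \<le> - (p + 1)" using ts by linarith
      moreover have "2 * t * q \<le> 0 \<or> 2 * (-t) * q \<le> 0"
        using t1 by (auto simp: zero_le_mult_iff mult_le_0_iff)
      ultimately show False using assms[of t] assms[of "-t"] by auto
    qed
    have "0 \<le> p + 2 * (- q / s) * q + (- q / s)\<^sup>2 * s" by (rule assms)
    then show ?thesis using s by (simp add: field_simps power2_eq_square)
  qed
qed

section \<open>Inner product and norm on representatives of L2 classes\<close>

definition L2_inner :: "'a measure \<Rightarrow> ('a \<Rightarrow> real) \<Rightarrow> ('a \<Rightarrow> real) \<Rightarrow> real" where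
  "L2_inner M f g = (\<integral>x. f x * g x \<partial>M)"

lemma L2_norm_sq_eq_inner: "L2_norm_sq M f = L2_inner M f f"
  by (simp add: L2_norm_sq_def L2_inner_def power2_eq_square)

lemma L2_norm_sq_nonneg [simp]: "0 \<le> L2_norm_sq M f"
  by (simp add: L2_norm_sq_def)

lemma L2_measurable: "f \<in> L2 M \<Longrightarrow> f \<in> borel_measurable M"
  by (simp add: L2_def)

lemma L2_integrable_square: "f \<in> L2 M \<Longrightarrow> integrable M (\<lambda>x. (f x)\<^sup>2)"
  by (simp add: L2_def)

lemma L2_integrable_mult:
  assumes "f \<in> L2 M" "g \<in> L2 M"
  shows "integrable M (\<lambda>x. f x * g x)"
proof (rule Bochner_Integration.integrable_bound)
  show "integrable M (\<lambda>x. (f x)\<^sup>2 + (g x)\<^sup>2)"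
    using assms by (simp add: L2_def)
  have "\<bar>u * v\<bar> \<le> u\<^sup>2 + v\<^sup>2" for u v :: real
    using sum_squares_bound[of "\<bar>u\<bar>" "\<bar>v\<bar>"] mult_nonneg_nonneg[of "\<bar>u\<bar>" "\<bar>v\<bar>"]
    unfolding abs_mult power2_abs by linarith
  then show "AE x in M. norm (f x * g x) \<le> norm ((f x)\<^sup>2 + (g x)\<^sup>2)"
    by simp
qed (use assms in \<open>auto intro: L2_measurable borel_measurable_times\<close>)

lemma L2_zero_mem: "(\<lambda>x. 0) \<in> L2 M"
  by (simp add: L2_def)

lemma L2_cmult: "f \<in> L2 M \<Longrightarrow> (\<lambda>x. c * f x) \<in> L2 M"
  by (auto simp: L2_def power_mult_distrib)

lemma L2_add:
  assumes "f \<in> L2 M" "g \<in> L2 M"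
  shows "(\<lambda>x. f x + g x) \<in> L2 M"
  using assms L2_integrable_mult[OF assms]
  by (auto simp: L2_def power2_sum mult.assoc)

lemma L2_diff:
  assumes "f \<in> L2 M" "g \<in> L2 M"
  shows "(\<lambda>x. f x - g x) \<in> L2 M"
  using L2_add[OF assms(1) L2_cmult[OF assms(2), of "-1"]] by simp

lemma L2_sum:
  assumes "\<And>i. i \<in> I \<Longrightarrow> f i \<in> L2 M"
  shows "(\<lambda>x. \<Sum>i\<in>I. f i x) \<in> L2 M"
  using assms by (induction I rule: infinite_finite_induct) (auto intro: L2_zero_mem L2_add)

lemma (in finite_measure) L2_bounded:
  assumes "f \<in> borel_measurable M" "\<And>x. x \<in> space M \<Longrightarrow> \<bar>f x\<bar> \<le> B"
  shows "f \<in> L2 M"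
proof -
  have "integrable M (\<lambda>x. (f x)\<^sup>2)"
    using assms by (intro integrable_const_bound[where B = "B\<^sup>2"])
      (auto intro!: AE_I2 simp: abs_le_square_iff[symmetric] intro: order_trans[OF _ abs_ge_self])
  then show ?thesis using assms by (simp add: L2_def)
qed

lemma (in finite_measure) L2_integrable:
  assumes "f \<in> L2 M"
  shows "integrable M f"
  using L2_integrable_mult[OF assms L2_bounded[of "\<lambda>x. 1" 1]] by simp

lemma L2_mult_bounded:
  assumes f: "f \<in> L2 M" and g: "g \<in> borel_measurable M"
    and bound: "\<And>x. x \<in> space M \<Longrightarrow> \<bar>g x\<bar> \<le> B"
  shows "(\<lambda>x. g x * f x) \<in> L2 M"
    and "L2_norm_sq M (\<lambda>x. g x * f x) \<le> B\<^sup>2 * L2_norm_sq M f"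
proof -
  have *: "(g x * f x)\<^sup>2 \<le> B\<^sup>2 * (f x)\<^sup>2" if "x \<in> space M" for x
    using bound[OF that] abs_le_square_iff[of "g x" B]
    by (auto simp: power_mult_distrib intro!: mult_right_mono)
  have i: "integrable M (\<lambda>x. B\<^sup>2 * (f x)\<^sup>2)" using L2_integrable_square[OF f] by simp
  have i': "integrable M (\<lambda>x. (g x * f x)\<^sup>2)"
    by (rule Bochner_Integration.integrable_bound[OF i])
      (use * L2_measurable[OF f] g in \<open>auto intro!: AE_I2 borel_measurable_times borel_measurable_power\<close>)
  show "(\<lambda>x. g x * f x) \<in> L2 M"
    using i' L2_measurable[OF f] g by (simp add: L2_def)
  have "(\<integral>x. (g x * f x)\<^sup>2 \<partial>M) \<le> (\<integral>x. B\<^sup>2 * (f x)\<^sup>2 \<partial>M)"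
    by (rule integral_mono[OF i' i *])
  then show "L2_norm_sq M (\<lambda>x. g x * f x) \<le> B\<^sup>2 * L2_norm_sq M f"
    by (simp add: L2_norm_sq_def)
qed

lemma L2_inner_commute: "L2_inner M f g = L2_inner M g f"
  by (simp add: L2_inner_def mult.commute)

lemma L2_inner_add_left:
  "f \<in> L2 M \<Longrightarrow> g \<in> L2 M \<Longrightarrow> h \<in> L2 M \<Longrightarrow>
    L2_inner M (\<lambda>x. f x + g x) h = L2_inner M f h + L2_inner M g h"
  by (simp add: L2_inner_def distrib_right L2_integrable_mult)

lemma L2_inner_diff_left:
  "f \<in> L2 M \<Longrightarrow> g \<in> L2 M \<Longrightarrow> h \<in> L2 M \<Longrightarrow>
    L2_inner M (\<lambda>x. f x - g x) h = L2_inner M f h - L2_inner M g h"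
  by (simp add: L2_inner_def left_diff_distrib L2_integrable_mult)

lemma L2_inner_cmult_left: "L2_inner M (\<lambda>x. c * f x) h = c * L2_inner M f h"
  by (simp add: L2_inner_def mult.assoc)

lemma L2_inner_sum_left:
  assumes "\<And>i. i \<in> I \<Longrightarrow> f i \<in> L2 M" "h \<in> L2 M"
  shows "L2_inner M (\<lambda>x. \<Sum>i\<in>I. f i x) h = (\<Sum>i\<in>I. L2_inner M (f i) h)"
  using assms
  by (simp add: L2_inner_def sum_distrib_right L2_integrable_mult Bochner_Integration.integral_sum)

lemma L2_inner_add_right:
  "f \<in> L2 M \<Longrightarrow> g \<in> L2 M \<Longrightarrow> h \<in> L2 M \<Longrightarrow>
    L2_inner M h (\<lambda>x. f x + g x) = L2_inner M h f + L2_inner M h g"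
  by (simp add: L2_inner_commute[of M h] L2_inner_add_left)

lemma L2_inner_cmult_right: "L2_inner M h (\<lambda>x. c * f x) = c * L2_inner M h f"
  by (simp add: L2_inner_commute[of M h] L2_inner_cmult_left)

lemma L2_inner_cong_AE:
  assumes "f \<in> L2 M" "f' \<in> L2 M" "g \<in> L2 M" "g' \<in> L2 M"
    and "AE x in M. f x = f' x" "AE x in M. g x = g' x"
  shows "L2_inner M f g = L2_inner M f' g'"
  unfolding L2_inner_def
  using assms by (intro integral_cong_AE) (auto intro: L2_measurable borel_measurable_times)

lemma L2_norm_sq_cmult: "L2_norm_sq M (\<lambda>x. c * f x) = c\<^sup>2 * L2_norm_sq M f"
  by (simp add: L2_norm_sq_def power_mult_distrib)

lemma L2_norm_sq_add_cmult:
  assumes "f \<in> L2 M" "g \<in> L2 M"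
  shows "L2_norm_sq M (\<lambda>x. f x + t * g x) =
    L2_norm_sq M f + 2 * t * L2_inner M f g + t\<^sup>2 * L2_norm_sq M g"
proof -
  note m = L2_cmult[OF assms(2), of t]
  have "L2_norm_sq M (\<lambda>x. f x + t * g x) =
    L2_inner M f f + t * L2_inner M f g + (t * L2_inner M g f + t * (t * L2_inner M g g))"
    by (simp add: L2_norm_sq_eq_inner L2_inner_add_left[OF assms(1) m L2_add[OF assms(1) m]]
        L2_inner_add_right[OF assms(1) m assms(1)] L2_inner_add_right[OF assms(1) m assms(2)]
        L2_inner_cmult_left L2_inner_cmult_right distrib_left)
  then show ?thesis
    by (simp add: L2_norm_sq_eq_inner L2_inner_commute[of M g f] power2_eq_square)
qed

lemma L2_Cauchy_Schwarz:
  assumes "f \<in> L2 M" "g \<in> L2 M"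
  shows "(L2_inner M f g)\<^sup>2 \<le> L2_norm_sq M f * L2_norm_sq M g"
  using L2_norm_sq_nonneg[of M "\<lambda>x. f x + t * g x" for t]
  by (intro nonneg_quadratic_imp_discriminant_le) (simp only: L2_norm_sq_add_cmult[OF assms])

lemma L2_Cauchy_Schwarz_abs:
  assumes "f \<in> L2 M" "g \<in> L2 M"
  shows "\<bar>L2_inner M f g\<bar> \<le> sqrt (L2_norm_sq M f) * sqrt (L2_norm_sq M g)"
  using real_sqrt_le_mono[OF L2_Cauchy_Schwarz[OF assms]] by (simp add: real_sqrt_mult)

lemma (in finite_measure) L2_integral_abs_le:
  assumes "f \<in> L2 M"
  shows "(\<integral>x. \<bar>f x\<bar> \<partial>M) \<le> sqrt (measure M (space M)) * sqrt (L2_norm_sq M f)"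
proof -
  have 1: "(\<lambda>x. 1) \<in> L2 M" by (rule L2_bounded[of _ 1]) auto
  have a: "(\<lambda>x. \<bar>f x\<bar>) \<in> L2 M" using assms by (auto simp: L2_def)
  show ?thesis
    using L2_Cauchy_Schwarz_abs[OF 1 a] by (simp add: L2_inner_def L2_norm_sq_def)
qed

lemma (in finite_measure) L2_set_integral_abs_le:
  assumes f: "f \<in> L2 M" and A: "A \<in> sets M"
  shows "\<bar>LINT y:A|M. f y\<bar> \<le> sqrt (measure M A) * sqrt (L2_norm_sq M f)"
proof -
  have i: "(indicator A :: _ \<Rightarrow> real) \<in> L2 M"
    by (rule L2_bounded[of _ 1]) (auto simp: A borel_measurable_indicator indicator_le_1)
  have "(indicator A x :: real)\<^sup>2 = indicator A x" for x by (simp add: indicator_def)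
  then have "L2_norm_sq M (indicator A) = measure M A"
    using A by (simp add: L2_norm_sq_def)
  then show ?thesis
    using L2_Cauchy_Schwarz_abs[OF i f] by (simp add: L2_inner_def set_lebesgue_integral_def)
qed

lemma L2_norm_sq_eq_0_iff:
  "f \<in> L2 M \<Longrightarrow> L2_norm_sq M f = 0 \<longleftrightarrow> f \<in> L2_zero M"
  by (simp add: L2_norm_sq_def L2_zero_def integral_nonneg_eq_0_iff_AE[OF L2_integrable_square])

lemma L2_inner_tendsto:
  assumes F: "\<And>j. F j \<in> L2 M" and f: "f \<in> L2 M" and g: "g \<in> L2 M"
    and conv: "(\<lambda>j. L2_norm_sq M (\<lambda>x. F j x - f x)) \<longlonglongrightarrow> 0"
  shows "(\<lambda>j. L2_inner M (F j) g) \<longlonglongrightarrow> L2_inner M f g"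
proof -
  have "(\<lambda>j. L2_inner M (F j) g - L2_inner M f g) \<longlonglongrightarrow> 0"
  proof (rule Lim_null_comparison)
    show "\<forall>\<^sub>F j in sequentially. norm (L2_inner M (F j) g - L2_inner M f g)
        \<le> sqrt (L2_norm_sq M (\<lambda>x. F j x - f x)) * sqrt (L2_norm_sq M g)"
      using L2_Cauchy_Schwarz_abs[OF L2_diff[OF F f] g]
      by (simp add: L2_inner_diff_left[OF F f g])
    show "(\<lambda>j. sqrt (L2_norm_sq M (\<lambda>x. F j x - f x)) * sqrt (L2_norm_sq M g)) \<longlonglongrightarrow> 0"
      using tendsto_mult_left_zero[OF tendsto_real_sqrt[OF conv, unfolded real_sqrt_zero]] by simp
  qed
  then show ?thesis by (simp add: LIM_zero_iff)
qed

lemma L2_norm_sq_tendsto: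
  assumes F: "\<And>j. F j \<in> L2 M" and f: "f \<in> L2 M"
    and conv: "(\<lambda>j. L2_norm_sq M (\<lambda>x. F j x - f x)) \<longlonglongrightarrow> 0"
  shows "(\<lambda>j. L2_norm_sq M (F j)) \<longlonglongrightarrow> L2_norm_sq M f"
proof -
  have "L2_norm_sq M (F j) =
      L2_norm_sq M (\<lambda>x. F j x - f x) + 2 * L2_inner M (F j) f - L2_norm_sq M f" for j
    using L2_norm_sq_add_cmult[OF F[of j] f, of "-1"] by simp
  then have "(\<lambda>j. L2_norm_sq M (F j)) = (\<lambda>j. L2_norm_sq M (\<lambda>x. F j x - f x)
      + 2 * L2_inner M (F j) f - L2_norm_sq M f)" by blast
  moreover have "(\<lambda>j. L2_norm_sq M (\<lambda>x. F j x - f x)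
      + 2 * L2_inner M (F j) f - L2_norm_sq M f) \<longlonglongrightarrow> 0 + 2 * L2_inner M f f - L2_norm_sq M f"
    by (intro tendsto_intros conv L2_inner_tendsto[OF F f f conv])
  ultimately show ?thesis by (simp add: L2_norm_sq_eq_inner)
qed

text \<open>Gaussian elimination: an equation with a nonzero coefficient at \<open>p\<close> removes
  the unknown \<open>p\<close> from the others, so equations and unknowns decrease together. General
  index sets allow an arbitrary unknown to be removed.\<close>

lemma exists_common_kernel:
  fixes A :: "'j \<Rightarrow> 'i \<Rightarrow> real"
  assumes "finite I" "finite J" "card J < card I"
  shows "\<exists>c. (\<exists>i\<in>I. c i \<noteq> 0) \<and> (\<forall>j\<in>J. (\<Sum>i\<in>I. A j i * c i) = 0)"
  using assms(2,1,3)
proof (induction J arbitrary: A I rule: finite_induct)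
  case empty
  then show ?case by (intro exI[of _ "\<lambda>_. 1"]) (auto simp: card_gt_0_iff)
next
  case (insert j J)
  show ?case
  proof (cases "\<forall>i\<in>I. A j i = 0")
    case True
    have "card J < card I" using insert by simp
    then obtain c where c: "\<exists>i\<in>I. c i \<noteq> 0" "\<forall>j\<in>J. (\<Sum>i\<in>I. A j i * c i) = 0"
      using insert.IH[OF insert.prems(1)] by blast
    show ?thesis using c True by (intro exI[of _ c]) simp
  next
    case False
    then obtain p where p: "p \<in> I" "A j p \<noteq> 0" by blast
    have "card J < card (I - {p})" using insert p by (simp add: card_Diff_singleton)
    then obtain c where c: "\<exists>i\<in>I - {p}. c i \<noteq> 0"
      "\<forall>j'\<in>J. (\<Sum>i\<in>I - {p}. (A j' i - A j' p * A j i / A j p) * c i) = 0"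
      using insert.IH[of "I - {p}" "\<lambda>j' i. A j' i - A j' p * A j i / A j p"] insert.prems by auto
    define s where "s = (\<Sum>i\<in>I - {p}. A j i * c i)"
    \<comment> \<open>Equation \<open>j\<close> forces this value at \<open>p\<close>; inserted into
      the other equations it produces the reduced coefficients.\<close>
    define d where "d = c(p := - s / A j p)"
    have sum: "(\<Sum>i\<in>I. A j' i * d i) = A j' p * (- s / A j p) + (\<Sum>i\<in>I - {p}. A j' i * c i)" for j'
      using sum.remove[OF insert.prems(1) p(1), of "\<lambda>i. A j' i * d i"]
      by (simp add: d_def)
    have "(\<Sum>i\<in>I. A j' i * d i) = 0" if "j' \<in> J" for j'
    proof -
      have "(\<Sum>i\<in>I - {p}. A j' i * c i) - A j' p / A j p * s = 0"
        using c(2)[rule_format, OF that]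
        unfolding s_def sum_distrib_left sum_subtractf[symmetric]
        by (simp add: algebra_simps)
      then show ?thesis by (simp add: sum)
    qed
    moreover have "(\<Sum>i\<in>I. A j i * d i) = 0" using p by (simp add: sum s_def[symmetric])
    moreover have "\<exists>i\<in>I. d i \<noteq> 0" using c(1) by (auto simp: d_def)
    ultimately show ?thesis by auto
  qed
qed

section \<open>Compact perturbations of a multiplication operator\<close>

text \<open>Compactness enters as pointwise convergence; with the uniform bound
  \<open>K_abs_le\<close>, dominated convergence upgrades it to norm convergence. The assumptions on
  \<open>K\<close> hold at every point, so eigenvalue equations will hold everywhere and not just
  almost everywhere.\<close>

locale compactly_perturbed_multiplication = finite_measure M
  for M :: "'a measure" +
  fixes a :: "'a \<Rightarrow> real" and K :: "('a \<Rightarrow> real) \<Rightarrow> 'a \<Rightarrow> real" and B c :: real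
  assumes a_measurable: "a \<in> borel_measurable M"
    and a_ge_1: "x \<in> space M \<Longrightarrow> 1 \<le> a x"
    and a_le: "x \<in> space M \<Longrightarrow> a x \<le> B"
    and K_measurable: "f \<in> L2 M \<Longrightarrow> K f \<in> borel_measurable M"
    and K_add: "f \<in> L2 M \<Longrightarrow> g \<in> L2 M \<Longrightarrow> x \<in> space M \<Longrightarrow>
      K (\<lambda>x. f x + g x) x = K f x + K g x"
    and K_cmult: "f \<in> L2 M \<Longrightarrow> x \<in> space M \<Longrightarrow> K (\<lambda>x. t * f x) x = t * K f x"
    and K_abs_le: "f \<in> L2 M \<Longrightarrow> x \<in> space M \<Longrightarrow> \<bar>K f x\<bar> \<le> c * sqrt (L2_norm_sq M f)"
    and K_symmetric: "f \<in> L2 M \<Longrightarrow> g \<in> L2 M \<Longrightarrow> L2_inner M (K f) g = L2_inner M f (K g)"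
    and K_compact: "(\<And>j. F j \<in> L2 M) \<Longrightarrow> (\<And>j. L2_norm_sq M (F j) \<le> 1) \<Longrightarrow>
      \<exists>s. strict_mono (s :: nat \<Rightarrow> nat) \<and> (\<forall>x\<in>space M. convergent (\<lambda>j. K (F (s j)) x))"
    and form_nonneg': "f \<in> L2 M \<Longrightarrow> 0 \<le> L2_inner M (\<lambda>x. a x * f x - K f x) f"
begin

section \<open>The operator \<open>T\<close> and its quadratic form\<close>

definition T :: "('a \<Rightarrow> real) \<Rightarrow> 'a \<Rightarrow> real" where
  "T f x = a x * f x - K f x"

definition form :: "('a \<Rightarrow> real) \<Rightarrow> real" where
  "form f = L2_inner M (T f) f"

lemma form_nonneg: "f \<in> L2 M \<Longrightarrow> 0 \<le> form f"
  using form_nonneg' by (simp add: form_def T_def[abs_def])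

lemma K_L2: "f \<in> L2 M \<Longrightarrow> K f \<in> L2 M"
  using L2_bounded[OF K_measurable K_abs_le] by blast

lemma abs_a_le: "x \<in> space M \<Longrightarrow> \<bar>a x\<bar> \<le> B"
  using a_ge_1 a_le by fastforce

lemma T_L2: "f \<in> L2 M \<Longrightarrow> T f \<in> L2 M"
  unfolding T_def[abs_def]
  by (intro L2_diff L2_mult_bounded(1)[OF _ a_measurable abs_a_le] K_L2)

lemma T_add:
  "f \<in> L2 M \<Longrightarrow> g \<in> L2 M \<Longrightarrow> x \<in> space M \<Longrightarrow> T (\<lambda>x. f x + g x) x = T f x + T g x"
  by (simp add: T_def K_add algebra_simps)

lemma T_cmult: "f \<in> L2 M \<Longrightarrow> x \<in> space M \<Longrightarrow> T (\<lambda>x. t * f x) x = t * T f x"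
  by (simp add: T_def K_cmult algebra_simps)

lemma T_zero: "x \<in> space M \<Longrightarrow> T (\<lambda>x. 0) x = 0"
  using T_cmult[OF L2_zero_mem, of x 0] by simp

lemma T_sum:
  assumes "\<And>i. i \<in> I \<Longrightarrow> f i \<in> L2 M" "x \<in> space M"
  shows "T (\<lambda>x. \<Sum>i\<in>I. f i x) x = (\<Sum>i\<in>I. T (f i) x)"
  using assms
proof (induction I rule: infinite_finite_induct)
  case (insert i I)
  then show ?case by (simp add: T_add L2_sum)
qed (simp_all add: T_zero)

lemma T_symmetric:
  assumes "f \<in> L2 M" "g \<in> L2 M"
  shows "L2_inner M (T f) g = L2_inner M f (T g)"
proof -
  have af: "(\<lambda>x. a x * h x) \<in> L2 M" if "h \<in> L2 M" for h
    using L2_mult_bounded(1)[OF that a_measurable abs_a_le] .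
  have "L2_inner M (T f) g = L2_inner M (\<lambda>x. a x * f x) g - L2_inner M (K f) g"
    unfolding T_def[abs_def] by (rule L2_inner_diff_left[OF af[OF assms(1)] K_L2[OF assms(1)] assms(2)])
  moreover have "L2_inner M f (T g) = L2_inner M (\<lambda>x. a x * g x) f - L2_inner M (K g) f"
    unfolding T_def[abs_def] L2_inner_commute[of M f]
    by (rule L2_inner_diff_left[OF af[OF assms(2)] K_L2[OF assms(2)] assms(1)])
  moreover have "L2_inner M (\<lambda>x. a x * f x) g = L2_inner M (\<lambda>x. a x * g x) f"
    by (simp add: L2_inner_def mult_ac)
  ultimately show ?thesis
    using K_symmetric[OF assms] by (simp add: L2_inner_commute[of M f])
qed

lemma form_add_cmult:
  assumes f: "f \<in> L2 M" and g: "g \<in> L2 M"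
  shows "form (\<lambda>x. f x + t * g x) = form f + 2 * t * L2_inner M (T f) g + t\<^sup>2 * form g"
proof -
  note tg = L2_cmult[OF g, of t] and Tf = T_L2[OF f] and tTg = L2_cmult[OF T_L2[OF g], of t]
  have "form (\<lambda>x. f x + t * g x) =
      L2_inner M (\<lambda>x. T f x + t * T g x) (\<lambda>x. f x + t * g x)"
    unfolding form_def L2_inner_def
    by (intro Bochner_Integration.integral_cong) (simp_all add: T_add[OF f tg] T_cmult[OF g])
  also have "\<dots> = form f + t * L2_inner M (T f) g + (t * L2_inner M (T g) f + t * (t * form g))"
    by (simp add: L2_inner_add_left[OF Tf tTg L2_add[OF f tg]] L2_inner_add_right[OF f tg Tf]
        L2_inner_add_right[OF f tg T_L2[OF g]] L2_inner_cmult_left L2_inner_cmult_right form_def distrib_left)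
  also have "L2_inner M (T g) f = L2_inner M (T f) g"
    using T_symmetric[OF f g] by (simp add: L2_inner_commute[of M f])
  finally show ?thesis by (simp add: power2_eq_square)
qed

lemma form_cmult: "f \<in> L2 M \<Longrightarrow> form (\<lambda>x. t * f x) = t\<^sup>2 * form f"
proof -
  assume f: "f \<in> L2 M"
  have "form (\<lambda>x. t * f x) = L2_inner M (\<lambda>x. t * T f x) (\<lambda>x. t * f x)"
    unfolding form_def L2_inner_def
    by (intro Bochner_Integration.integral_cong) (simp_all add: T_cmult[OF f])
  then show ?thesis
    by (simp add: form_def L2_inner_cmult_left L2_inner_cmult_right power2_eq_square)
qed

text \<open>By \<open>K_abs_le\<close>, \<open>K (f - g)\<close> vanishes at every point once
  \<open>f - g\<close> has norm zero, so only the multiplication part leaves an exceptional null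
  set.\<close>

lemma T_cong_AE:
  assumes f: "f \<in> L2 M" and g: "g \<in> L2 M" and ae: "AE x in M. f x = g x"
  shows "AE x in M. T f x = T g x"
proof -
  have "L2_norm_sq M (\<lambda>x. f x - g x) = 0"
    using ae L2_diff[OF f g] by (subst L2_norm_sq_eq_0_iff) (auto simp: L2_zero_def)
  then have z: "K (\<lambda>x. f x + (-1) * g x) x = 0" if "x \<in> space M" for x
    using K_abs_le[OF L2_diff[OF f g] that] by simp
  have "K f x = K g x" if "x \<in> space M" for x
    using z[OF that] K_add[OF f L2_cmult[OF g, of "-1"] that] K_cmult[OF g that, of "-1"] by simp
  with ae show ?thesis by (auto simp: T_def)
qed

lemma form_cong_AE:
  assumes f: "f \<in> L2 M" and g: "g \<in> L2 M" and ae: "AE x in M. f x = g x"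
  shows "form f = form g"
  unfolding form_def
  by (intro L2_inner_cong_AE T_L2 f g ae T_cong_AE)

text \<open>This bound turns small excess energy into a small residual in
  \<open>minimiser_exists\<close>. The \<open>K\<close> part is at most the supremum of
  \<open>K f\<close> times the L1 norm of \<open>f\<close>; the sign of \<open>c\<close> is not
  prescribed, hence the absolute value.\<close>

lemma form_le:
  assumes f: "f \<in> L2 M"
  shows "form f \<le> (B + \<bar>c\<bar> * sqrt (measure M (space M))) * L2_norm_sq M f"
proof -
  note af = L2_mult_bounded(1)[OF f a_measurable abs_a_le]
  have i: "integrable M (\<lambda>x. \<bar>f x\<bar>)" using L2_integrable[OF f] by simp
  have eq: "form f = (\<integral>x. a x * (f x)\<^sup>2 \<partial>M) - (\<integral>x. K f x * f x \<partial>M)"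
    using L2_inner_diff_left[OF af K_L2[OF f] f]
    by (simp add: form_def T_def[abs_def] L2_inner_def power2_eq_square mult.assoc)
  have "(\<integral>x. a x * (f x)\<^sup>2 \<partial>M) \<le> (\<integral>x. B * (f x)\<^sup>2 \<partial>M)"
    using L2_integrable_mult[OF af f] L2_integrable_square[OF f]
    by (intro integral_mono) (auto simp: power2_eq_square mult.assoc intro!: mult_right_mono a_le)
  also have "(\<integral>x. B * (f x)\<^sup>2 \<partial>M) = B * L2_norm_sq M f" by (simp add: L2_norm_sq_def)
  finally have le1: "(\<integral>x. a x * (f x)\<^sup>2 \<partial>M) \<le> B * L2_norm_sq M f" .
  have "- (\<integral>x. K f x * f x \<partial>M) \<le> (\<integral>x. \<bar>c\<bar> * sqrt (L2_norm_sq M f) * \<bar>f x\<bar> \<partial>M)"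
  proof -
    have "- (K f x * f x) \<le> \<bar>c\<bar> * sqrt (L2_norm_sq M f) * \<bar>f x\<bar>" if "x \<in> space M" for x
    proof -
      have "\<bar>K f x\<bar> \<le> \<bar>c\<bar> * sqrt (L2_norm_sq M f)"
        using K_abs_le[OF f that] by (rule order_trans) (intro mult_right_mono, auto)
      then have "\<bar>K f x * f x\<bar> \<le> \<bar>c\<bar> * sqrt (L2_norm_sq M f) * \<bar>f x\<bar>"
        unfolding abs_mult by (intro mult_right_mono) auto
      then show ?thesis by linarith
    qed
    then have "(\<integral>x. - (K f x * f x) \<partial>M) \<le> (\<integral>x. \<bar>c\<bar> * sqrt (L2_norm_sq M f) * \<bar>f x\<bar> \<partial>M)"
      using L2_integrable_mult[OF K_L2[OF f] f] i by (intro integral_mono) auto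
    then show ?thesis by simp
  qed
  also have "\<dots> = \<bar>c\<bar> * sqrt (L2_norm_sq M f) * (\<integral>x. \<bar>f x\<bar> \<partial>M)" by simp
  also have "\<dots> \<le> \<bar>c\<bar> * sqrt (L2_norm_sq M f) * (sqrt (measure M (space M)) * sqrt (L2_norm_sq M f))"
    by (intro mult_left_mono L2_integral_abs_le f) auto
  also have "\<dots> = \<bar>c\<bar> * sqrt (measure M (space M)) * L2_norm_sq M f"
    using real_sqrt_mult_self[of "L2_norm_sq M f"] by (simp add: mult_ac del: real_sqrt_mult_self)
  finally show ?thesis using eq le1 by (simp add: distrib_right)
qed

text \<open>
  An almost minimising sequence \<open>F\<close> satisfies \<open>(T - m) F j \<rightarrow> 0\<close>; since \<open>a - m\<close> is bounded below,
  convergence of \<open>K (F j)\<close> along a subsequence forces convergence of \<open>F j\<close> itself.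
\<close>

lemma approximate_eigenfunctions_converge:
  assumes F: "\<And>j. F j \<in> L2 M" and F1: "\<And>j. L2_norm_sq M (F j) = 1" and m: "m < 1"
    and conv: "(\<lambda>j. L2_norm_sq M (\<lambda>x. T (F j) x - m * F j x)) \<longlonglongrightarrow> 0"
  obtains s f where "strict_mono (s :: nat \<Rightarrow> nat)" "f \<in> L2 M"
    "(\<lambda>j. L2_norm_sq M (\<lambda>x. F (s j) x - f x)) \<longlonglongrightarrow> 0"
    "\<And>x. x \<in> space M \<Longrightarrow> T f x = m * f x"
proof -
  obtain s where s: "strict_mono (s :: nat \<Rightarrow> nat)"
    and sc: "\<And>x. x \<in> space M \<Longrightarrow> convergent (\<lambda>j. K (F (s j)) x)"
    using K_compact[of F] F F1 by auto
  define h where "h x = lim (\<lambda>j. K (F (s j)) x)" for x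
  have h: "(\<lambda>j. K (F (s j)) x) \<longlonglongrightarrow> h x" if "x \<in> space M" for x
    using sc[OF that] by (simp add: h_def convergent_LIMSEQ_iff)
  have h_meas: "h \<in> borel_measurable M"
    by (rule borel_measurable_LIMSEQ_real[OF h K_measurable[OF F]])
  have K_le: "\<bar>K (F j) x\<bar> \<le> c" if "x \<in> space M" for x j
    using K_abs_le[OF F[of j] that] by (simp add: F1)
  have h_le: "\<bar>h x\<bar> \<le> c" if "x \<in> space M" for x
    using K_le[OF that] by (intro LIMSEQ_le_const2[OF tendsto_rabs[OF h[OF that]]]) auto
  have am: "1 - m \<le> a x - m" "0 < a x - m" if "x \<in> space M" for x
    using a_ge_1[OF that] m by auto
  \<comment> \<open>The limit has to solve \<open>(a - m) f = h\<close>.\<close>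
  define f where "f x = h x / (a x - m)" for x
  have f_meas: "f \<in> borel_measurable M"
    unfolding f_def[abs_def] using h_meas a_measurable by simp
  have "\<bar>f x\<bar> \<le> c / (1 - m)" if "x \<in> space M" for x
    using h_le[OF that] am[OF that] m unfolding f_def abs_divide
    by (intro frac_le) auto
  then have f: "f \<in> L2 M" by (rule L2_bounded[OF f_meas])
  define g where "g j = (\<lambda>x. T (F (s j)) x - m * F (s j) x)" for j
  have g: "g j \<in> L2 M" for j
    unfolding g_def by (intro L2_diff T_L2 L2_cmult F)
  have gc: "(\<lambda>j. L2_norm_sq M (g j)) \<longlonglongrightarrow> 0"
    using LIMSEQ_subseq_LIMSEQ[OF conv s] by (simp add: g_def o_def)
  have hL2: "h \<in> L2 M" by (rule L2_bounded[OF h_meas h_le])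
  have Kh: "(\<lambda>j. L2_norm_sq M (\<lambda>x. K (F (s j)) x - h x)) \<longlonglongrightarrow> 0"
  proof -
    have "(\<lambda>j. \<integral>x. (K (F (s j)) x - h x)\<^sup>2 \<partial>M) \<longlonglongrightarrow> (\<integral>x. 0 \<partial>M)"
    proof (rule integral_dominated_convergence[where w = "\<lambda>x. (2 * c)\<^sup>2"])
      show "AE x in M. (\<lambda>j. (K (F (s j)) x - h x)\<^sup>2) \<longlonglongrightarrow> 0"
        using tendsto_power[OF LIM_zero[OF h], of _ 2] by (intro AE_I2) simp
      show "AE x in M. norm ((K (F (s j)) x - h x)\<^sup>2) \<le> (2 * c)\<^sup>2" for j
      proof (rule AE_I2)
        fix x assume "x \<in> space M"
        then have "\<bar>K (F (s j)) x - h x\<bar> \<le> \<bar>2 * c\<bar>"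
          using K_le[of x "s j"] h_le[of x] by linarith
        then show "norm ((K (F (s j)) x - h x)\<^sup>2) \<le> (2 * c)\<^sup>2"
          by (simp only: abs_le_square_iff real_norm_def abs_power2)
      qed
    qed (use K_measurable[OF F] h_meas in auto)
    then show ?thesis by (simp add: L2_norm_sq_def)
  qed
  have Ff: "(\<lambda>j. L2_norm_sq M (\<lambda>x. F (s j) x - f x)) \<longlonglongrightarrow> 0"
  proof (rule Lim_null_comparison)
    \<comment> \<open>Both factors come from \<open>(a - m) (F - f) = g + (K F - h)\<close>:
      \<open>1 / (1 - m)\<close> bounds the inverse multiplier, and 2 comes from
      \<open>|u + v|^2 <= 2 |u|^2 + 2 |v|^2\<close> in norm.\<close>
    let ?bd = "\<lambda>j. (1 / (1 - m))\<^sup>2 * (2 * L2_norm_sq M (g j) + 2 * L2_norm_sq M (\<lambda>x. K (F (s j)) x - h x))"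
    show "?bd \<longlonglongrightarrow> 0"
      using tendsto_mult[OF tendsto_const tendsto_add[OF tendsto_mult[OF tendsto_const gc]
          tendsto_mult[OF tendsto_const Kh]]] by fastforce
    have "L2_norm_sq M (\<lambda>x. F (s j) x - f x) \<le> ?bd j" for j
    proof -
      let ?k = "\<lambda>x. K (F (s j)) x - h x"
      have k: "?k \<in> L2 M" by (intro L2_diff K_L2 F hL2)
      have eq: "F (s j) x - f x = 1 / (a x - m) * (g j x + ?k x)" if "x \<in> space M" for x
        using am[OF that] by (simp add: g_def f_def T_def field_simps)
      have "L2_norm_sq M (\<lambda>x. F (s j) x - f x) = L2_norm_sq M (\<lambda>x. 1 / (a x - m) * (g j x + ?k x))"
        unfolding L2_norm_sq_def by (intro Bochner_Integration.integral_cong) (simp_all only: eq)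
      also have "\<dots> \<le> (1 / (1 - m))\<^sup>2 * L2_norm_sq M (\<lambda>x. g j x + ?k x)"
      proof (rule L2_mult_bounded(2)[OF L2_add[OF g k]])
        show "(\<lambda>x. 1 / (a x - m)) \<in> borel_measurable M" using a_measurable by simp
        show "\<bar>1 / (a x - m)\<bar> \<le> 1 / (1 - m)" if "x \<in> space M" for x
          using am[OF that] m by (simp add: frac_le)
      qed
      also have "L2_norm_sq M (\<lambda>x. g j x + ?k x) \<le> 2 * L2_norm_sq M (g j) + 2 * L2_norm_sq M ?k"
        using L2_norm_sq_add_cmult[OF g[of j] k, of 1] L2_norm_sq_add_cmult[OF g[of j] k, of "-1"]
          L2_norm_sq_nonneg[of M "\<lambda>x. g j x + (-1) * ?k x"] by simp
      finally show ?thesis by (simp add: mult_left_mono)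
    qed
    then show "\<forall>\<^sub>F j in sequentially. norm (L2_norm_sq M (\<lambda>x. F (s j) x - f x)) \<le> ?bd j" by simp
  qed
  have "T f x = m * f x" if x: "x \<in> space M" for x
  proof -
    \<comment> \<open>Norm convergence gives pointwise convergence under \<open>K\<close>, so
      \<open>h = K f\<close> everywhere and the definition of \<open>f\<close> becomes the
      eigenvalue equation.\<close>
    have "(\<lambda>j. K (F (s j)) x - K f x) \<longlonglongrightarrow> 0"
    proof (rule Lim_null_comparison)
      have "K (F (s j)) x - K f x = K (\<lambda>x. F (s j) x + (-1) * f x) x" for j
        using K_add[OF F[of "s j"] L2_cmult[OF f, of "-1"] x] K_cmult[OF f x, of "-1"] by simp
      then show "\<forall>\<^sub>F j in sequentially. norm (K (F (s j)) x - K f x)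
          \<le> c * sqrt (L2_norm_sq M (\<lambda>x. F (s j) x - f x))"
        using K_abs_le[OF L2_diff[OF F f] x] by simp
      show "(\<lambda>j. c * sqrt (L2_norm_sq M (\<lambda>x. F (s j) x - f x))) \<longlonglongrightarrow> 0"
        using tendsto_mult[OF tendsto_const tendsto_real_sqrt[OF Ff]] by fastforce
    qed
    then have "h x = K f x" by (rule LIMSEQ_unique[OF h[OF x] LIM_zero_cancel])
    then show ?thesis using am[OF x] by (simp add: T_def f_def field_simps)
  qed
  with s f Ff show ?thesis using that by blast
qed

section \<open>Successive minimisation on orthogonal complements\<close>

definition orth :: "nat \<Rightarrow> (nat \<Rightarrow> 'a \<Rightarrow> real) \<Rightarrow> ('a \<Rightarrow> real) set" where
  "orth n \<phi> = {f \<in> L2 M. \<forall>i<n. L2_inner M f (\<phi> i) = 0}"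

text \<open>The competitor \<open>f0\<close> puts the infimum \<open>m\<close> below 1.
  Nonnegativity of \<open>form - m * norm^2\<close> on the complement shows that a minimising
  sequence consists of approximate eigenfunctions, and below 1 these converge along a
  subsequence.\<close>

lemma minimiser_exists:
  assumes \<phi>: "\<And>i. i < n \<Longrightarrow> \<phi> i \<in> L2 M"
    and eig: "\<And>i x. i < n \<Longrightarrow> x \<in> space M \<Longrightarrow> T (\<phi> i) x = l i * \<phi> i x"
    and f0: "f0 \<in> orth n \<phi>" "form f0 < L2_norm_sq M f0"
  shows "\<exists>f\<in>orth n \<phi>. \<exists>m. L2_norm_sq M f = 1 \<and> (\<forall>x\<in>space M. T f x = m * f x) \<and>
    (\<forall>g\<in>orth n \<phi>. m * L2_norm_sq M g \<le> form g)"
proof -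
  have L2: "f \<in> L2 M" if "f \<in> orth n \<phi>" for f using that by (simp add: orth_def)
  have cm: "(\<lambda>x. t * f x) \<in> orth n \<phi>" if "f \<in> orth n \<phi>" for f t
    using that by (simp add: orth_def L2_cmult L2_inner_cmult_left)
  have add: "(\<lambda>x. f x + g x) \<in> orth n \<phi>" if "f \<in> orth n \<phi>" "g \<in> orth n \<phi>" for f g
    using that \<phi> by (simp add: orth_def L2_add L2_inner_add_left)
  \<comment> \<open>Symmetry of \<open>T\<close> moves it onto the eigenfunctions
    \<open>\<phi> i\<close>. The residuals \<open>g j\<close> thus stay in the complement, where
    minimality may be applied to them.\<close>
  have T_orth: "T f \<in> orth n \<phi>" if f: "f \<in> orth n \<phi>" for f
  proof -
    have "L2_inner M (T f) (\<phi> i) = 0" if i: "i < n" for i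
    proof -
      have "L2_inner M (T f) (\<phi> i) = L2_inner M f (T (\<phi> i))"
        by (rule T_symmetric[OF L2[OF f] \<phi>[OF i]])
      also have "\<dots> = L2_inner M f (\<lambda>x. l i * \<phi> i x)"
        unfolding L2_inner_def by (intro Bochner_Integration.integral_cong) (simp_all add: eig[OF i])
      finally show ?thesis using f i by (simp add: L2_inner_cmult_right orth_def)
    qed
    then show ?thesis using T_L2[OF L2[OF f]] by (simp add: orth_def)
  qed
  define S where "S = {f \<in> orth n \<phi>. L2_norm_sq M f = 1}"
  define m where "m = Inf (form ` S)"
  have bdd: "bdd_below (form ` S)"
    using form_nonneg L2 by (intro bdd_belowI[of _ 0]) (auto simp: S_def)
  have normalize: "(\<lambda>x. 1 / sqrt (L2_norm_sq M f) * f x) \<in> S"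
      "form (\<lambda>x. 1 / sqrt (L2_norm_sq M f) * f x) = form f / L2_norm_sq M f"
    if "f \<in> orth n \<phi>" "0 < L2_norm_sq M f" for f
  proof -
    have "(1 / sqrt (L2_norm_sq M f))\<^sup>2 = 1 / L2_norm_sq M f"
      using that by (simp add: power_divide)
    then show "(\<lambda>x. 1 / sqrt (L2_norm_sq M f) * f x) \<in> S"
      "form (\<lambda>x. 1 / sqrt (L2_norm_sq M f) * f x) = form f / L2_norm_sq M f"
      unfolding S_def mem_Collect_eq using cm[OF that(1)] form_cmult[OF L2[OF that(1)]] that(2)
      by (simp_all only: L2_norm_sq_cmult) auto
  qed
  have f0pos: "0 < L2_norm_sq M f0" using form_nonneg[OF L2[OF f0(1)]] f0(2) by linarith
  have ne: "S \<noteq> {}" using normalize(1)[OF f0(1) f0pos] by blast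
  have m_nonneg: "0 \<le> m"
    unfolding m_def using ne form_nonneg L2 by (intro cINF_greatest) (auto simp: S_def)
  have m1: "m < 1"
  proof -
    have "m \<le> form f0 / L2_norm_sq M f0"
      unfolding m_def using normalize[OF f0(1) f0pos] by (metis bdd cINF_lower)
    also have "\<dots> < 1" using f0pos f0(2) by simp
    finally show ?thesis .
  qed
  have min: "m * L2_norm_sq M g \<le> form g" if g: "g \<in> orth n \<phi>" for g
  proof (cases "L2_norm_sq M g = 0")
    case True then show ?thesis using form_nonneg[OF L2[OF g]] by simp
  next
    case False
    then have pos: "0 < L2_norm_sq M g" using L2_norm_sq_nonneg[of M g] by linarith
    have "m \<le> form g / L2_norm_sq M g"
      unfolding m_def using normalize[OF g pos] by (metis bdd cINF_lower)
    then show ?thesis using pos by (simp add: field_simps)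
  qed
  have "\<exists>f\<in>S. form f < m + 1 / Suc j" for j
  proof -
    have "Inf (form ` S) < m + 1 / Suc j" by (simp add: m_def)
    then show ?thesis using cInf_lessD[of "form ` S"] ne by blast
  qed
  then obtain F where FS: "\<And>j. F j \<in> S" and Fm: "\<And>j. form (F j) < m + 1 / Suc j" by metis
  have Fo: "F j \<in> orth n \<phi>" and F1: "L2_norm_sq M (F j) = 1" for j
    using FS[of j] by (auto simp: S_def)
  note F = L2[OF Fo]
  define g where "g j = (\<lambda>x. T (F j) x + (- m) * F j x)" for j
  have go: "g j \<in> orth n \<phi>" for j unfolding g_def by (intro add T_orth cm Fo)
  \<comment> \<open>The maximum with 0 keeps \<open>D / Suc j\<close> nonnegative, which settles the
    case of a vanishing residual.\<close>
  define D where "D = max 0 (B + \<bar>c\<bar> * sqrt (measure M (space M)))"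
  have g_le: "L2_norm_sq M (g j) \<le> D / Suc j" for j
  proof -
    note gL = L2[OF go[of j]]
    let ?q = "\<lambda>f. form f - m * L2_norm_sq M f"
    \<comment> \<open>Cauchy-Schwarz for the semi-definite form \<open>?q\<close>. As
      \<open>g j\<close> is the residual of \<open>F j\<close>, the mixed term is the whole squared
      norm of \<open>g j\<close>. Its square is thus bounded by the excess energy of
      \<open>F j\<close> times a multiple of that squared norm.\<close>
    have "(L2_inner M (T (F j)) (g j) - m * L2_inner M (F j) (g j))\<^sup>2 \<le> ?q (F j) * ?q (g j)"
    proof (rule nonneg_quadratic_imp_discriminant_le)
      fix t
      show "0 \<le> ?q (F j) + 2 * t * (L2_inner M (T (F j)) (g j) - m * L2_inner M (F j) (g j)) + t\<^sup>2 * ?q (g j)"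
        using min[OF add[OF Fo[of j] cm[OF go[of j], of t]]]
        by (simp add: form_add_cmult[OF F gL] L2_norm_sq_add_cmult[OF F gL] algebra_simps)
    qed
    also have "L2_inner M (T (F j)) (g j) - m * L2_inner M (F j) (g j) = L2_norm_sq M (g j)"
      using L2_inner_add_left[OF T_L2[OF F[of j]] L2_cmult[OF F[of j], of "-m"] gL]
        L2_inner_cmult_left[of M "-m" "F j" "g j"]
      by (simp add: g_def L2_norm_sq_eq_inner)
    also have "?q (F j) * ?q (g j) \<le> 1 / Suc j * (D * L2_norm_sq M (g j))"
    proof (rule mult_mono)
      show "?q (F j) \<le> 1 / Suc j" using Fm[of j] by (simp add: F1)
      have "form (g j) \<le> D * L2_norm_sq M (g j)"
        using form_le[OF gL] by (rule order_trans) (auto simp: D_def intro!: mult_right_mono)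
      then show "?q (g j) \<le> D * L2_norm_sq M (g j)"
        using mult_nonneg_nonneg[OF m_nonneg L2_norm_sq_nonneg[of M "g j"]] by linarith
      show "0 \<le> ?q (g j)" using min[OF go] by simp
    qed simp
    finally have le: "L2_norm_sq M (g j) * L2_norm_sq M (g j) \<le> D / Suc j * L2_norm_sq M (g j)"
      by (simp add: power2_eq_square)
    show ?thesis
    proof (cases "L2_norm_sq M (g j) = 0")
      case True then show ?thesis by (simp add: D_def)
    next
      case False
      then have "0 < L2_norm_sq M (g j)" using L2_norm_sq_nonneg[of M "g j"] by linarith
      then show ?thesis by (rule mult_right_le_imp_le[OF le])
    qed
  qed
  have "(\<lambda>j. L2_norm_sq M (g j)) \<longlonglongrightarrow> 0"
  proof (rule Lim_null_comparison)
    show "\<forall>\<^sub>F j in sequentially. norm (L2_norm_sq M (g j)) \<le> D / Suc j" using g_le by simp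
    show "(\<lambda>j. D / Suc j) \<longlonglongrightarrow> 0" by (rule LIMSEQ_Suc[OF lim_const_over_n])
  qed
  then have "(\<lambda>j. L2_norm_sq M (\<lambda>x. T (F j) x - m * F j x)) \<longlonglongrightarrow> 0" by (simp add: g_def)
  from approximate_eigenfunctions_converge[where F = F, OF F F1 m1 this]
  obtain s f where s: "strict_mono (s :: nat \<Rightarrow> nat)" and f: "f \<in> L2 M"
    and sf: "(\<lambda>j. L2_norm_sq M (\<lambda>x. F (s j) x - f x)) \<longlonglongrightarrow> 0"
    and Tf: "\<And>x. x \<in> space M \<Longrightarrow> T f x = m * f x"
    by blast
  have "L2_inner M f (\<phi> i) = 0" if i: "i < n" for i
    using L2_inner_tendsto[OF F f \<phi>[OF i] sf] Fo i
    by (simp add: orth_def LIMSEQ_const_iff)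
  then have "f \<in> orth n \<phi>" using f by (simp add: orth_def)
  moreover have "L2_norm_sq M f = 1"
    using L2_norm_sq_tendsto[OF F f sf] by (simp add: F1 LIMSEQ_const_iff)
  ultimately show ?thesis using Tf min by blast
qed


text \<open>The variational clause on all of \<open>orth i \<phi>\<close> is kept beside the
  eigenvalue equation: it gives the ordering of the values and the lower half of the min-max
  principle.\<close>

definition eigensystem :: "nat \<Rightarrow> (nat \<Rightarrow> 'a \<Rightarrow> real) \<Rightarrow> (nat \<Rightarrow> real) \<Rightarrow> bool" where
  "eigensystem n \<phi> l \<longleftrightarrow> (\<forall>i<n. \<phi> i \<in> orth i \<phi> \<and> L2_norm_sq M (\<phi> i) = 1 \<and>
     (\<forall>x\<in>space M. T (\<phi> i) x = l i * \<phi> i x) \<and>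
     (\<forall>g\<in>orth i \<phi>. l i * L2_norm_sq M g \<le> form g))"

lemma orth_cong: "(\<And>i. i < n \<Longrightarrow> \<phi> i = \<psi> i) \<Longrightarrow> orth n \<phi> = orth n \<psi>"
  by (auto simp: orth_def)

text \<open>The \<open>n\<close> orthogonality conditions are linear equations in
  \<open>m > n\<close> coefficients, and independence keeps the nontrivial solution from being null.
  It supplies competitors for the next minimisation and also meets an arbitrary subspace with a
  complement.\<close>

lemma exists_orth_combination:
  assumes b: "\<And>i. i < m \<Longrightarrow> b i \<in> L2 M" and indep: "L2_independent M m b"
    and \<phi>: "\<And>i. i < n \<Longrightarrow> \<phi> i \<in> L2 M" and "n < m"
  obtains d where "(\<lambda>x. \<Sum>i<m. d i * b i x) \<in> orth n \<phi>"
    "(\<lambda>x. \<Sum>i<m. d i * b i x) \<notin> L2_zero M"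
proof -
  obtain d where d: "\<exists>i<m. d i \<noteq> 0" "\<forall>j<n. (\<Sum>i<m. L2_inner M (b i) (\<phi> j) * d i) = 0"
    using exists_common_kernel[of "{..<m}" "{..<n}" "\<lambda>j i. L2_inner M (b i) (\<phi> j)"] \<open>n < m\<close>
    by auto
  have L2: "(\<lambda>x. \<Sum>i<m. d i * b i x) \<in> L2 M"
    using b by (intro L2_sum L2_cmult) auto
  have "L2_inner M (\<lambda>x. \<Sum>i<m. d i * b i x) (\<phi> j) = 0" if "j < n" for j
    using b \<phi>[OF that] d(2) that
    by (subst L2_inner_sum_left) (auto simp: L2_inner_cmult_left L2_cmult mult.commute)
  moreover have "(\<lambda>x. \<Sum>i<m. d i * b i x) \<notin> L2_zero M"
    using indep d(1) by (auto simp: L2_zero_def L2_independent_def)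
  ultimately show ?thesis using that L2 by (auto simp: orth_def)
qed

text \<open>By \<open>small\<close>, Rayleigh quotients on the span of the \<open>b i\<close> are
  below 1. For \<open>n < k\<close> this span contains a nonnull function orthogonal to the
  \<open>n\<close> minimisers already found, so the next minimum is again below 1.\<close>

lemma eigensystem_exists:
  assumes b: "\<And>i. i < k \<Longrightarrow> b i \<in> L2 M" and indep: "L2_independent M k b"
    and small: "\<And>d. (\<lambda>x. \<Sum>i<k. d i * b i x) \<notin> L2_zero M \<Longrightarrow>
      form (\<lambda>x. \<Sum>i<k. d i * b i x) < L2_norm_sq M (\<lambda>x. \<Sum>i<k. d i * b i x)"
  shows "\<exists>\<phi> l. eigensystem k \<phi> l"
proof -
  have "n \<le> k \<Longrightarrow> \<exists>\<phi> l. eigensystem n \<phi> l" for n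
  proof (induction n)
    case 0
    then show ?case by (simp add: eigensystem_def)
  next
    case (Suc n)
    then obtain \<phi> l where E: "eigensystem n \<phi> l" by auto
    have \<phi>: "\<And>i. i < n \<Longrightarrow> \<phi> i \<in> L2 M"
      and eig: "\<And>i x. i < n \<Longrightarrow> x \<in> space M \<Longrightarrow> T (\<phi> i) x = l i * \<phi> i x"
      using E by (auto simp: eigensystem_def orth_def)
    have "n < k" using Suc.prems by simp
    from exists_orth_combination[where \<phi> = \<phi> and n = n, OF b indep \<phi> this]
    obtain d where d: "(\<lambda>x. \<Sum>i<k. d i * b i x) \<in> orth n \<phi>"
      "(\<lambda>x. \<Sum>i<k. d i * b i x) \<notin> L2_zero M" by blast
    obtain f m where f: "f \<in> orth n \<phi>" "L2_norm_sq M f = 1"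
      "\<And>x. x \<in> space M \<Longrightarrow> T f x = m * f x"
      "\<And>g. g \<in> orth n \<phi> \<Longrightarrow> m * L2_norm_sq M g \<le> form g"
      using minimiser_exists[where l = l, OF \<phi> eig d(1) small[OF d(2)]] by auto
    \<comment> \<open>\<open>orth i\<close> reads only the entries below \<open>i\<close>, so
      appending at position \<open>n\<close> leaves the earlier clauses intact.\<close>
    have o: "orth i (\<phi>(n := f)) = orth i \<phi>" if "i \<le> n" for i
      using that by (intro orth_cong) auto
    have "eigensystem (Suc n) (\<phi>(n := f)) (l(n := m))"
      using E f by (auto simp: eigensystem_def less_Suc_eq o)
    then show ?case by blast
  qed
  then show ?thesis by blast
qed

section \<open>Ordering of the eigenvalues and both halves of the min-max principle\<close>

context
  fixes n \<phi> l
  assumes E: "eigensystem n \<phi> l"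
begin

lemma eigensystem_L2: "i < n \<Longrightarrow> \<phi> i \<in> L2 M"
  using E by (simp add: eigensystem_def orth_def)

lemma eigensystem_T: "i < n \<Longrightarrow> x \<in> space M \<Longrightarrow> T (\<phi> i) x = l i * \<phi> i x"
  using E by (simp add: eigensystem_def)

lemma eigensystem_min: "i < n \<Longrightarrow> g \<in> orth i \<phi> \<Longrightarrow> l i * L2_norm_sq M g \<le> form g"
  using E by (simp add: eigensystem_def)

lemma eigensystem_orthonormal:
  assumes "i < n" "j < n"
  shows "L2_inner M (\<phi> i) (\<phi> j) = (if i = j then 1 else 0)"
proof -
  have "L2_inner M (\<phi> i) (\<phi> j) = 0" if "j < i" "i < n" for i j
    using E that by (simp add: eigensystem_def orth_def)
  from this[of j i] this[of i j] show ?thesis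
    using E assms by (cases i j rule: linorder_cases)
      (auto simp: eigensystem_def L2_norm_sq_eq_inner L2_inner_commute[of M "\<phi> i"])
qed

lemma eigensystem_sum_inner:
  assumes "m \<le> n" "j < m"
  shows "L2_inner M (\<lambda>x. \<Sum>i<m. d i * \<phi> i x) (\<phi> j) = d j"
proof -
  have "L2_inner M (\<lambda>x. \<Sum>i<m. d i * \<phi> i x) (\<phi> j) = (\<Sum>i<m. d i * (if i = j then 1 else 0))"
    using assms by (subst L2_inner_sum_left)
      (auto simp: L2_inner_cmult_left L2_cmult eigensystem_L2 eigensystem_orthonormal)
  then show ?thesis using assms by (simp add: sum.delta if_distrib[of "(*) _"] cong: if_cong)
qed

lemma eigensystem_sum_inner_sum:
  assumes "m \<le> n"
  shows "L2_inner M (\<lambda>x. \<Sum>i<m. d i * \<phi> i x) (\<lambda>x. \<Sum>i<m. e i * \<phi> i x) = (\<Sum>i<m. d i * e i)"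
proof -
  have L2: "(\<lambda>x. \<Sum>i<m. d i * \<phi> i x) \<in> L2 M"
    using assms by (intro L2_sum L2_cmult eigensystem_L2) auto
  have "L2_inner M (\<lambda>x. \<Sum>i<m. d i * \<phi> i x) (\<lambda>x. \<Sum>i<m. e i * \<phi> i x) =
      (\<Sum>j<m. e j * L2_inner M (\<phi> j) (\<lambda>x. \<Sum>i<m. d i * \<phi> i x))"
    unfolding L2_inner_commute[of M "\<lambda>x. \<Sum>i<m. d i * \<phi> i x"]
    using L2 assms by (subst L2_inner_sum_left)
      (auto simp: L2_inner_cmult_left L2_cmult eigensystem_L2)
  then show ?thesis
    using assms by (simp add: L2_inner_commute[of M "\<phi> _"] eigensystem_sum_inner mult.commute)
qed

lemma eigensystem_form_sum:
  assumes "m \<le> n"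
  shows "form (\<lambda>x. \<Sum>i<m. d i * \<phi> i x) = (\<Sum>i<m. l i * (d i)\<^sup>2)"
proof -
  have "T (\<lambda>x. \<Sum>i<m. d i * \<phi> i x) x = (\<Sum>i<m. (d i * l i) * \<phi> i x)" if "x \<in> space M" for x
    using that assms
    by (subst T_sum) (auto simp: T_cmult eigensystem_L2 eigensystem_T L2_cmult mult.assoc)
  then have "form (\<lambda>x. \<Sum>i<m. d i * \<phi> i x) =
      L2_inner M (\<lambda>x. \<Sum>i<m. (d i * l i) * \<phi> i x) (\<lambda>x. \<Sum>i<m. d i * \<phi> i x)"
    unfolding form_def L2_inner_def by (intro Bochner_Integration.integral_cong) auto
  also have "\<dots> = (\<Sum>i<m. d i * l i * d i)" by (rule eigensystem_sum_inner_sum[OF assms])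
  finally show ?thesis by (simp add: power2_eq_square mult_ac)
qed

lemma eigensystem_norm_sq_sum:
  "m \<le> n \<Longrightarrow> L2_norm_sq M (\<lambda>x. \<Sum>i<m. d i * \<phi> i x) = (\<Sum>i<m. (d i)\<^sup>2)"
  by (simp add: L2_norm_sq_eq_inner eigensystem_sum_inner_sum power2_eq_square)

lemma eigensystem_form:
  assumes "i < n"
  shows "form (\<phi> i) = l i"
proof -
  have "form (\<phi> i) = L2_inner M (\<lambda>x. l i * \<phi> i x) (\<phi> i)"
    unfolding form_def L2_inner_def
    using assms by (intro Bochner_Integration.integral_cong) (auto simp: eigensystem_T)
  then show ?thesis using assms by (simp add: L2_inner_cmult_left eigensystem_orthonormal)
qed

lemma eigensystem_nonneg: "i < n \<Longrightarrow> 0 \<le> l i"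
  using form_nonneg[OF eigensystem_L2] by (simp add: eigensystem_form)

text \<open>\<open>\<phi> j\<close> is itself a competitor in the earlier minimisation over
  \<open>orth i \<phi>\<close>.\<close>

lemma eigensystem_mono:
  assumes "i \<le> j" "j < n"
  shows "l i \<le> l j"
proof -
  have "\<phi> j \<in> orth i \<phi>"
    using assms by (simp add: orth_def eigensystem_L2 eigensystem_orthonormal)
  then show ?thesis
    using eigensystem_min[of i "\<phi> j"] assms
    by (simp add: eigensystem_form L2_norm_sq_eq_inner eigensystem_orthonormal)
qed

lemma eigensystem_independent:
  assumes "m \<le> n"
  shows "L2_independent M m \<phi>"
  unfolding L2_independent_def
proof (intro allI impI)
  fix d i assume ae: "AE x in M. (\<Sum>i<m. d i * \<phi> i x) = 0" and i: "i < m"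
  have "(\<lambda>x. \<Sum>i<m. d i * \<phi> i x) \<in> L2 M"
    using assms by (intro L2_sum L2_cmult eigensystem_L2) auto
  then have "L2_norm_sq M (\<lambda>x. \<Sum>i<m. d i * \<phi> i x) = 0"
    using ae by (subst L2_norm_sq_eq_0_iff) (auto simp: L2_zero_def)
  then show "d i = 0"
    using assms i by (simp add: eigensystem_norm_sq_sum sum_nonneg_eq_0_iff)
qed

text \<open>Upper half of the min-max principle: on the span of the first \<open>i + 1\<close>
  eigenfunctions the form is diagonal with largest entry \<open>l i\<close>.\<close>

lemma eigensystem_span:
  assumes "i < n"
  obtains V where "L2_subspace M V" "L2_has_dim M V (i + 1)"
    "\<And>f. f \<in> V \<Longrightarrow> form f \<le> l i * L2_norm_sq M f"
proof
  define P where "P d = (\<lambda>x. \<Sum>j<i + 1. d j * \<phi> j x)" for d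
  \<comment> \<open>The span is saturated under almost everywhere equality, as
    \<open>L2_subspace\<close> demands.\<close>
  define V where "V = {f \<in> L2 M. \<exists>d. AE x in M. f x = P d x}"
  have P: "P d \<in> L2 M" for d
    unfolding P_def using assms by (intro L2_sum L2_cmult eigensystem_L2) auto
  show "L2_subspace M V"
    unfolding L2_subspace_def
  proof (intro conjI ballI allI impI)
    show "V \<subseteq> L2 M" by (auto simp: V_def)
    show "(\<lambda>x. 0) \<in> V"
      by (auto simp: V_def L2_zero_mem P_def intro!: exI[of _ "\<lambda>_. 0"])
    show "(\<lambda>x. f x + g x) \<in> V" if fg: "f \<in> V" "g \<in> V" for f g
    proof -
      obtain d e where "AE x in M. f x = P d x" "AE x in M. g x = P e x"
        using fg by (auto simp: V_def)
      then have "AE x in M. f x + g x = P (\<lambda>j. d j + e j) x"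
        by eventually_elim (simp add: P_def sum.distrib distrib_right)
      then show ?thesis using fg L2_add by (auto simp: V_def)
    qed
    show "(\<lambda>x. t * f x) \<in> V" if f: "f \<in> V" for f t
    proof -
      obtain d where "AE x in M. f x = P d x" using f by (auto simp: V_def)
      then have "AE x in M. t * f x = P (\<lambda>j. t * d j) x"
        by eventually_elim (simp add: P_def sum_distrib_left distrib_left mult.assoc)
      then show ?thesis using f L2_cmult by (auto simp: V_def)
    qed
    show "g \<in> V" if f: "f \<in> V" and g: "g \<in> L2 M" and ae: "AE x in M. f x = g x" for f g
    proof -
      obtain d where "AE x in M. f x = P d x" using f by (auto simp: V_def)
      with ae have "AE x in M. g x = P d x" by eventually_elim simp
      then show ?thesis using g by (auto simp: V_def)
    qed
  qed
  have "\<phi> j \<in> V" if "j < i + 1" for j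
  proof -
    have "P (\<lambda>m. if m = j then 1 else 0) x = \<phi> j x" for x
      unfolding P_def using that
      by (simp add: if_distrib[of "\<lambda>y. y * _"] sum.delta cong: if_cong del: sum.lessThan_Suc)
    then have "AE x in M. \<phi> j x = P (\<lambda>m. if m = j then 1 else 0) x" by simp
    then show ?thesis using that assms eigensystem_L2 by (fastforce simp: V_def)
  qed
  then show "L2_has_dim M V (i + 1)"
    unfolding L2_has_dim_def
    using eigensystem_independent[of "i + 1"] assms by (intro exI[of _ \<phi>]) (auto simp: V_def P_def)
  show "form f \<le> l i * L2_norm_sq M f" if f: "f \<in> V" for f
  proof -
    obtain d where d: "AE x in M. f x = P d x" and fL: "f \<in> L2 M"
      using f by (auto simp: V_def)
    have "form f = (\<Sum>j<i + 1. l j * (d j)\<^sup>2)"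
      using form_cong_AE[OF fL P d] eigensystem_form_sum[of "i + 1" d] assms by (simp add: P_def)
    also have "\<dots> \<le> (\<Sum>j<i + 1. l i * (d j)\<^sup>2)"
      using assms by (intro sum_mono mult_right_mono eigensystem_mono) auto
    also have "\<dots> = l i * L2_norm_sq M f"
      using L2_inner_cong_AE[OF fL P fL P d d] eigensystem_norm_sq_sum[of "i + 1" d] assms
      by (simp add: P_def L2_norm_sq_eq_inner sum_distrib_left distrib_left)
    finally show ?thesis .
  qed
qed

text \<open>Lower half of the min-max principle: \<open>i\<close> orthogonality conditions cannot
  annihilate a space of dimension \<open>i + 1\<close>, and on \<open>orth i \<phi>\<close> the
  minimum property applies.\<close>

lemma eigensystem_le_subspace:
  assumes "i < n" and V: "L2_subspace M V" "L2_has_dim M V (i + 1)"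
  obtains f where "f \<in> V - L2_zero M" "l i * L2_norm_sq M f \<le> form f"
proof -
  obtain b where b: "\<And>j. j < i + 1 \<Longrightarrow> b j \<in> V" "L2_independent M (i + 1) b"
    using V(2) by (auto simp: L2_has_dim_def)
  have bL: "b j \<in> L2 M" if "j < i + 1" for j
    using b(1)[OF that] V(1) by (auto simp: L2_subspace_def)
  obtain d where d: "(\<lambda>x. \<Sum>j<i + 1. d j * b j x) \<in> orth i \<phi>"
    "(\<lambda>x. \<Sum>j<i + 1. d j * b j x) \<notin> L2_zero M"
    using exists_orth_combination[OF bL b(2), of i \<phi>] eigensystem_L2 assms by auto
  have "(\<lambda>x. \<Sum>j<m. d j * b j x) \<in> V" if "m \<le> i + 1" for m
    using that
  proof (induction m)
    case 0
    then show ?case using V(1) by (simp add: L2_subspace_def)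
  next
    case (Suc m)
    then have "(\<lambda>x. \<Sum>j<m. d j * b j x) \<in> V" "(\<lambda>x. d m * b m x) \<in> V"
      using b(1)[of m] V(1) by (auto simp: L2_subspace_def)
    then show ?case using V(1) by (auto simp: L2_subspace_def)
  qed
  then have "(\<lambda>x. \<Sum>j<i + 1. d j * b j x) \<in> V - L2_zero M" using d(2) by blast
  then show ?thesis using that eigensystem_min[OF assms(1) d(1)] by blast
qed

end

end

section \<open>The kernel of the symmetrized operator\<close>

lemma compact_UNIV_countable_dense:
  assumes "compact (UNIV :: 'a::metric_space set)"
  obtains D :: "'a::metric_space set" where "countable D" "\<And>x e. 0 < e \<Longrightarrow> \<exists>z\<in>D. dist x z < e"
proof -
  have "\<exists>k. finite k \<and> (UNIV :: 'a set) \<subseteq> (\<Union>x\<in>k. ball x (1 / Suc n))" for n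
    using assms[unfolded compact_eq_totally_bounded] by (metis of_nat_0_less_iff zero_less_Suc zero_less_divide_1_iff)
  then obtain N where N: "\<And>n. finite (N n)" "\<And>n. (UNIV :: 'a set) \<subseteq> (\<Union>x\<in>N n. ball x (1 / Suc n))"
    by metis
  show ?thesis
  proof
    show "countable (\<Union>n. N n)" using N(1) by (auto intro: countable_finite)
    fix x :: 'a and e :: real assume "0 < e"
    then obtain n where n: "1 / Suc n < e" using nat_approx_posE by blast
    have "x \<in> (\<Union>z\<in>N n. ball z (1 / Suc n))" using N(2) by blast
    then obtain z where "z \<in> N n" "dist x z < 1 / Suc n" by (auto simp: dist_commute)
    with n show "\<exists>z\<in>\<Union>n. N n. dist x z < e" by (intro bexI[of _ z]) auto
  qed
qed

section \<open>Finiteness, measurability and weak compactness on a compact space\<close>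

locale compact_mm_space =
  fixes M :: "'a::metric_space measure"
  assumes mm: "metric_measure_space M" and compact_UNIV: "compact (UNIV :: 'a set)"
begin

lemma sets_M [measurable_cong, simp]: "sets M = sets borel"
  using mm by (simp add: metric_measure_space_def regular_borel_def)

lemma space_M [simp]: "space M = UNIV"
  using sets_eq_imp_space_eq[OF sets_M] by simp

text \<open>Compactness implies boundedness, so the whole space is a single ball, and balls have
  finite measure.\<close>

sublocale finite_measure M
proof
  obtain z :: 'a where True by blast
  obtain R where R: "0 < R" "UNIV \<subseteq> ball z R"
    using bounded_subset_ballD[OF compact_imp_bounded[OF compact_UNIV]] by blast
  then have "ball z R = UNIV" by blast
  then show "emeasure M (space M) \<noteq> \<infinity>"
    using mm R(1) by (metis space_M metric_measure_space_def infinity_ennreal_def order_less_irrefl)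
qed

lemma vol_pos: "0 < r \<Longrightarrow> 0 < vol M x r"
  using mm by (simp add: metric_measure_space_def fully_supported_def emeasure_eq_measure)

lemma measure_UNIV_pos: "0 < measure M UNIV"
proof -
  obtain z :: 'a where True by blast
  have "0 < vol M z 1" by (rule vol_pos) simp
  also have "\<dots> \<le> measure M UNIV" by (rule finite_measure_mono) auto
  finally show ?thesis .
qed

text \<open>The product sigma-algebra of a general metric space may miss open sets of the product.
  Separability repairs this: the strip is a countable union of products of balls with a common
  centre \<open>z\<close> near \<open>x\<close> and radii \<open>q\<close>, \<open>r - q\<close>,
  where rational \<open>q\<close> lies strictly between \<open>dist x z\<close> and
  \<open>r - dist z y\<close>.\<close>

lemma dist_less_sets: "{p. dist (fst p) (snd p) < r} \<in> sets (M \<Otimes>\<^sub>M M)"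
proof -
  obtain D :: "'a set" where D: "countable D" "\<And>x e. 0 < e \<Longrightarrow> \<exists>z\<in>D. dist x z < e"
    using compact_UNIV_countable_dense[OF compact_UNIV] by blast
  have "{p. dist (fst p) (snd p) < r} = (\<Union>(z, q)\<in>D \<times> \<rat>. ball z q \<times> ball z (r - q))"
  proof (intro equalityI subsetI)
    fix p :: "'a \<times> 'a" assume "p \<in> {p. dist (fst p) (snd p) < r}"
    then obtain x y where p: "p = (x, y)" and xy: "dist x y < r" by (cases p) auto
    obtain z where z: "z \<in> D" "dist x z < (r - dist x y) / 2" using D(2) xy by (metis diff_gt_0_iff_gt half_gt_zero)
    have "dist z y \<le> dist x z + dist x y" using dist_triangle[of z y x] by (simp add: dist_commute)
    then have "dist x z < r - dist z y" using z(2) by (simp add: field_simps)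
    then obtain q where "q \<in> \<rat>" "dist x z < q" "q < r - dist z y" using Rats_dense_in_real by blast
    then show "p \<in> (\<Union>(z, q)\<in>D \<times> \<rat>. ball z q \<times> ball z (r - q))"
      using p z(1) by (auto simp: dist_commute intro!: bexI[of _ z] bexI[of _ q])
  next
    fix p assume "p \<in> (\<Union>(z, q)\<in>D \<times> \<rat>. ball z q \<times> ball z (r - q))"
    then obtain z q where zq: "dist z (fst p) < q" "dist z (snd p) < r - q" by auto
    then have "dist (fst p) (snd p) < r"
      using dist_triangle[of "fst p" "snd p" z] by (simp add: dist_commute)
    then show "p \<in> {p. dist (fst p) (snd p) < r}" by simp
  qed
  also have "\<dots> \<in> sets (M \<Otimes>\<^sub>M M)"
    using D(1) by (intro sets.countable_UN' countable_SIGMA countable_rat) (auto intro!: pair_measureI)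
  finally show ?thesis .
qed

lemma vol_measurable: "(\<lambda>x. vol M x r) \<in> borel_measurable M"
proof -
  have "Pair x -` {p. dist (fst p) (snd p) < r} = ball x r" for x :: 'a by auto
  then show ?thesis
    using measurable_emeasure_Pair[OF dist_less_sets, of r] by (simp add: measure_def)
qed

text \<open>Finitely many balls of radius \<open>r / 2\<close> cover the space, and every ball of
  radius \<open>r\<close> contains one of them. This makes the kernel bounded.\<close>

lemma vol_bounded_below:
  assumes "0 < r"
  obtains v where "0 < v" "\<And>x. v \<le> vol M x r"
proof -
  obtain N where N: "finite N" "(UNIV :: 'a set) \<subseteq> (\<Union>x\<in>N. ball x (r / 2))"
    using compact_UNIV[unfolded compact_eq_totally_bounded] assms by (meson half_gt_zero)
  define v where "v = Min ((\<lambda>z. vol M z (r / 2)) ` N)"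
  have ne: "N \<noteq> {}" using N(2) by auto
  show ?thesis
  proof
    show "0 < v" unfolding v_def using N(1) ne vol_pos assms by (subst Min_gr_iff) auto
    fix x
    obtain z where z: "z \<in> N" "dist z x < r / 2" using N(2) by fastforce
    have "ball z (r / 2) \<subseteq> ball x r"
    proof
      fix y assume "y \<in> ball z (r / 2)"
      then show "y \<in> ball x r" using z(2) dist_triangle[of x y z] by (simp add: dist_commute)
    qed
    then have "vol M z (r / 2) \<le> vol M x r" by (intro finite_measure_mono) auto
    moreover have "v \<le> vol M z (r / 2)" unfolding v_def using N(1) z(1) by (intro Min_le) auto
    ultimately show "v \<le> vol M x r" by simp
  qed
qed

text \<open>A diagonal argument treats countably many sets. An arbitrary open set is exhausted from
  inside by such sets, and Cauchy-Schwarz bounds the integral over the remainder by the root of its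
  measure, uniformly in the sequence.\<close>

lemma weakly_convergent_subsequence:
  assumes F: "\<And>j. F j \<in> L2 M" and bound: "\<And>j. L2_norm_sq M (F j) \<le> C"
  obtains s where "strict_mono (s :: nat \<Rightarrow> nat)"
    "\<And>U. open U \<Longrightarrow> convergent (\<lambda>j. LINT y:U|M. F (s j) y)"
proof -
  obtain D :: "'a set" where D: "countable D" "\<And>x e. 0 < e \<Longrightarrow> \<exists>z\<in>D. dist x z < e"
    using compact_UNIV_countable_dense[OF compact_UNIV] by blast
  define cov where "cov A = (\<Union>p\<in>A. ball (fst p :: 'a) (snd p))" for A
  \<comment> \<open>Index sets of finite unions of balls with centres in \<open>D\<close> and
    rational radii: a countable family whose increasing unions give all open sets.\<close>
  define \<A> where "\<A> = {A. finite A \<and> A \<subseteq> D \<times> (\<rat> :: real set)}"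
  have cov_sets [measurable]: "cov A \<in> sets M" for A
    unfolding cov_def sets_M by (intro borel_open open_UN ballI open_ball)
  have small: "\<bar>LINT y:A|M. F j y\<bar> \<le> sqrt (measure M A) * sqrt C" if "A \<in> sets M" for A j
    using order_trans[OF L2_set_integral_abs_le[OF F that] mult_left_mono] bound by simp
  have C: "0 \<le> C" using bound[of 0] L2_norm_sq_nonneg[of M "F 0"] by linarith
  have bd: "norm (LINT y:cov A|M. F j y) \<le> sqrt (measure M UNIV) * sqrt C" for A j
  proof -
    have "measure M (cov A) \<le> measure M UNIV" by (rule finite_measure_mono) auto
    then have "sqrt (measure M (cov A)) * sqrt C \<le> sqrt (measure M UNIV) * sqrt C"
      using C by (intro mult_right_mono) auto
    then show ?thesis using small[OF cov_sets, of A j] by simp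
  qed
  have "countable \<A>"
    unfolding \<A>_def using D(1) by (intro countable_Collect_finite_subset countable_SIGMA countable_rat)
  from function_convergent_subsequence[where f = "\<lambda>j A. LINT y:cov A|M. F j y", OF this bd]
  obtain s where s: "strict_mono (s :: nat \<Rightarrow> nat)"
    and sl: "\<And>A. A \<in> \<A> \<Longrightarrow> \<exists>l. (\<lambda>j. LINT y:cov A|M. F (s j) y) \<longlonglongrightarrow> l" by blast
  have "convergent (\<lambda>j. LINT y:U|M. F (s j) y)" if U: "open U" for U
  \<comment> \<open>The enumeration \<open>from_nat_into\<close> used below needs a nonempty index
    set.\<close>
  proof (cases "U = {}")
    case True
    then show ?thesis by (simp add: set_lebesgue_integral_def convergent_const)
  next
    case False
    define I where "I = {p \<in> D \<times> \<rat>. ball (fst p) (snd p) \<subseteq> U}"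
    have cover: "\<exists>p\<in>I. x \<in> ball (fst p) (snd p)" if x: "x \<in> U" for x
    proof -
      obtain e where e: "0 < e" "ball x e \<subseteq> U" using U x open_contains_ball by blast
      obtain z where z: "z \<in> D" "dist x z < e / 2" using D(2)[of "e / 2" x] e(1) by auto
      obtain q where q: "q \<in> \<rat>" "dist x z < q" "q < e / 2" using Rats_dense_in_real[OF z(2)] by blast
      have "ball z q \<subseteq> ball x e"
      proof
        fix y assume "y \<in> ball z q"
        then show "y \<in> ball x e" using z(2) q dist_triangle[of x y z] by simp
      qed
      then have "(z, q) \<in> I" using z q e by (auto simp: I_def)
      moreover have "x \<in> ball (fst (z, q)) (snd (z, q))" using q by (simp add: dist_commute)
      ultimately show ?thesis by blast
    qed
    have I: "countable I" "I \<noteq> {}"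
      using False cover D(1) by (auto simp: I_def intro!: countable_Collect countable_SIGMA countable_rat)
    define A where "A n = from_nat_into I ` {..<n}" for n
    have AI: "A n \<subseteq> I" for n using from_nat_into[OF I(2)] by (auto simp: A_def)
    have A: "A n \<in> \<A>" for n
      using subset_trans[OF AI[of n], of "D \<times> \<rat>"] by (auto simp: I_def \<A>_def) (simp add: A_def)
    have covU: "cov (A n) \<subseteq> U" for n using AI[of n] by (auto simp: cov_def I_def)
    have "(\<Union>n. cov (A n)) = U"
    proof (intro equalityI subsetI)
      fix x assume "x \<in> U"
      then obtain p where p: "p \<in> I" "x \<in> ball (fst p) (snd p)" using cover by blast
      obtain n where "p = from_nat_into I n" using from_nat_into_surj[OF I(1) p(1)] by metis
      then have "p \<in> A (Suc n)" by (simp add: A_def)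
      then show "x \<in> (\<Union>n. cov (A n))" using p(2) by (auto simp: cov_def)
    qed (use covU in blast)
    moreover have "incseq (\<lambda>n. cov (A n))"
      unfolding cov_def A_def by (intro incseq_SucI UN_mono image_mono) auto
    ultimately have "(\<lambda>n. measure M (cov (A n))) \<longlonglongrightarrow> measure M U"
      using finite_Lim_measure_incseq[of "\<lambda>n. cov (A n)"] cov_sets by (simp add: image_subset_iff)
    then have "(\<lambda>n. measure M U - measure M (cov (A n))) \<longlonglongrightarrow> measure M U - measure M U"
      by (intro tendsto_intros)
    moreover have Us: "U \<in> sets M" using U by simp
    ultimately have "(\<lambda>n. measure M (U - cov (A n))) \<longlonglongrightarrow> 0"
      by (simp add: finite_measure_Diff[OF Us cov_sets covU])
    from tendsto_mult[OF tendsto_real_sqrt[OF this] tendsto_const[of "sqrt C"]]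
    have lim: "(\<lambda>n. sqrt (measure M (U - cov (A n))) * sqrt C) \<longlonglongrightarrow> 0" by simp
    have split: "(LINT y:U|M. F j y) = (LINT y:cov (A n)|M. F j y) + (LINT y:U - cov (A n)|M. F j y)" for j n
    proof -
      have i: "set_integrable M S (F j)" if "S \<in> sets M" for S
        unfolding set_integrable_def by (rule integrable_mult_indicator[OF that L2_integrable[OF F]])
      have "U = cov (A n) \<union> (U - cov (A n))" using covU[of n] by blast
      then show ?thesis
        using set_integral_Un[of "cov (A n)" "U - cov (A n)" M "F j"] i Us cov_sets
        by (metis Diff_disjoint sets.Diff)
    qed
    show ?thesis
      unfolding Cauchy_convergent_iff[symmetric]
    proof (rule metric_CauchyI)
      fix e :: real assume e: "0 < e"
      \<comment> \<open>One third of \<open>e\<close> goes to the difference on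
        \<open>cov (A n)\<close>, and one to each of the two integrals over the remainder.\<close>
      obtain n where n: "sqrt (measure M (U - cov (A n))) * sqrt C < e / 3"
        using order_tendstoD(2)[OF lim, of "e / 3"] e by (auto simp: eventually_sequentially)
      have "Cauchy (\<lambda>j. LINT y:cov (A n)|M. F (s j) y)"
        using sl[OF A] by (simp add: Cauchy_convergent_iff convergent_def)
      then obtain N where N: "\<And>i j. N \<le> i \<Longrightarrow> N \<le> j \<Longrightarrow>
          dist (LINT y:cov (A n)|M. F (s i) y) (LINT y:cov (A n)|M. F (s j) y) < e / 3"
        using e by (meson Cauchy_def divide_pos_pos zero_less_numeral)
      show "\<exists>N. \<forall>i\<ge>N. \<forall>j\<ge>N. dist (LINT y:U|M. F (s i) y) (LINT y:U|M. F (s j) y) < e"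
      proof (intro exI[of _ N] allI impI)
        fix i j assume "N \<le> i" "N \<le> j"
        then have "\<bar>(LINT y:cov (A n)|M. F (s i) y) - (LINT y:cov (A n)|M. F (s j) y)\<bar> < e / 3"
          using N by (simp add: dist_real_def)
        moreover have "\<bar>LINT y:U - cov (A n)|M. F (s j) y\<bar> < e / 3" for j
          using small[of "U - cov (A n)" "s j"] n Us cov_sets by (meson order_le_less_trans sets.Diff)
        from this[of i] this[of j] have "\<bar>LINT y:U - cov (A n)|M. F (s i) y\<bar> < e / 3"
          "\<bar>LINT y:U - cov (A n)|M. F (s j) y\<bar> < e / 3" .
        ultimately show "dist (LINT y:U|M. F (s i) y) (LINT y:U|M. F (s j) y) < e"
          unfolding dist_real_def split[of _ n] by linarith
      qed
    qed
  qed
  with s show ?thesis using that by blast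
qed

end

section \<open>The kernel operator at a fixed scale \<open>r\<close>\<close>

locale amv_scale = compact_mm_space M for M :: "'a::metric_space measure" +
  fixes r :: real
  assumes r_pos: "0 < r"
begin

definition W :: "'a \<Rightarrow> real" where
  "W x = 1 / vol M x r"

definition kern :: "'a \<Rightarrow> 'a \<Rightarrow> real" where
  "kern x y = indicator (ball x r) y * (W x + W y)"

text \<open>Any upper bound serves; that one exists follows from
  \<open>vol_bounded_below\<close>.\<close>

definition wmax :: real where
  "wmax = (SOME w. \<forall>x. W x \<le> w)"

definition K :: "('a \<Rightarrow> real) \<Rightarrow> 'a \<Rightarrow> real" where
  "K f x = (\<integral>y. kern x y * f y \<partial>M)"

definition a :: "'a \<Rightarrow> real" where
  "a = K (\<lambda>_. 1)"

lemma W_pos: "0 < W x"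
  using vol_pos[OF r_pos] by (simp add: W_def)

lemma W_le: "W x \<le> wmax"
proof -
  obtain v where "0 < v" "\<And>x. v \<le> vol M x r" using vol_bounded_below[OF r_pos] by blast
  then have "\<forall>x. W x \<le> 1 / v" by (simp add: W_def frac_le)
  then show ?thesis unfolding wmax_def using someI_ex[of "\<lambda>w. \<forall>x. W x \<le> w"] by blast
qed

lemma wmax_pos: "0 < wmax"
  using W_pos W_le by (meson order_less_le_trans)

lemma W_measurable [measurable]: "W \<in> borel_measurable M"
  unfolding W_def[abs_def] using vol_measurable[of r] by simp

lemma kern_commute: "kern x y = kern y x"
  by (auto simp: kern_def indicator_def dist_commute)

lemma kern_nonneg: "0 \<le> kern x y"
  using W_pos[of x] W_pos[of y] by (simp add: kern_def)

lemma kern_le: "kern x y \<le> 2 * wmax"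
  using W_le[of x] W_le[of y] wmax_pos by (simp add: kern_def indicator_def)

lemma kern_measurable_pair: "(\<lambda>p. kern (fst p) (snd p)) \<in> borel_measurable (M \<Otimes>\<^sub>M M)"
proof -
  have "kern (fst p) (snd p) = indicator {p. dist (fst p) (snd p) < r} p * (W (fst p) + W (snd p))" for p
    by (simp add: kern_def indicator_def)
  moreover have "(\<lambda>p. indicator {p. dist (fst p) (snd p) < r} p * (W (fst p) + W (snd p)))
      \<in> borel_measurable (M \<Otimes>\<^sub>M M)"
    using dist_less_sets[of r] by measurable
  ultimately show ?thesis by presburger
qed

lemma kern_measurable: "kern x \<in> borel_measurable M"
  using measurable_compose[OF measurable_Pair1' kern_measurable_pair, of x] by simp

lemma kern_integrable:
  assumes "integrable M u"
  shows "integrable M (\<lambda>y. kern x y * u y)"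
proof (rule Bochner_Integration.integrable_bound)
  show "integrable M (\<lambda>y. 2 * wmax * u y)" using assms by simp
  show "(\<lambda>y. kern x y * u y) \<in> borel_measurable M"
    using kern_measurable[of x] assms by simp
  show "AE y in M. norm (kern x y * u y) \<le> norm (2 * wmax * u y)"
    using kern_nonneg kern_le wmax_pos by (intro AE_I2) (auto simp: abs_mult intro!: mult_right_mono)
qed

lemma K_measurable:
  assumes "u \<in> borel_measurable M"
  shows "K u \<in> borel_measurable M"
proof -
  have "(\<lambda>(x, y). kern x y * u y) \<in> borel_measurable (M \<Otimes>\<^sub>M M)"
    using kern_measurable_pair assms by (simp add: split_beta)
  then show ?thesis unfolding K_def[abs_def] by (rule borel_measurable_lebesgue_integral)
qed

lemma K_abs_le:
  assumes "integrable M u"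
  shows "\<bar>K u x\<bar> \<le> 2 * wmax * (\<integral>y. \<bar>u y\<bar> \<partial>M)"
proof -
  have "\<bar>K u x\<bar> \<le> (\<integral>y. \<bar>kern x y * u y\<bar> \<partial>M)"
    unfolding K_def by (rule integral_abs_bound)
  also have "\<dots> \<le> (\<integral>y. 2 * wmax * \<bar>u y\<bar> \<partial>M)"
  proof (rule integral_mono)
    show "integrable M (\<lambda>y. \<bar>kern x y * u y\<bar>)" using kern_integrable[OF assms] by simp
    show "integrable M (\<lambda>y. 2 * wmax * \<bar>u y\<bar>)" using assms by simp
    show "\<bar>kern x y * u y\<bar> \<le> 2 * wmax * \<bar>u y\<bar>" for y
      using kern_nonneg[of x y] kern_le[of x y] by (simp add: abs_mult mult_right_mono)
  qed
  finally show ?thesis by simp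
qed

lemma K_integrable:
  assumes "integrable M u"
  shows "integrable M (K u)"
  using K_abs_le[OF assms] K_measurable assms
  by (intro integrable_const_bound[where B = "2 * wmax * (\<integral>y. \<bar>u y\<bar> \<partial>M)"]) auto

text \<open>Fubini and symmetry of the kernel. Integrability is assumed instead of
  square-integrability because \<open>gap_integral\<close> applies this to the square of an L2
  function and the constant 1.\<close>

lemma K_symmetric:
  assumes u: "integrable M u" and v: "integrable M v"
  shows "(\<integral>x. K u x * v x \<partial>M) = (\<integral>x. u x * K v x \<partial>M)"
proof -
  interpret P: pair_sigma_finite M M ..
  have meas: "(\<lambda>(x, y). kern x y * u y * v x) \<in> borel_measurable (M \<Otimes>\<^sub>M M)"
    using kern_measurable_pair u v by (simp add: split_beta)
  have int: "integrable (M \<Otimes>\<^sub>M M) (\<lambda>(x, y). kern x y * u y * v x)"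
  proof (rule P.Fubini_integrable[OF meas])
    have "integrable M (\<lambda>x. K (\<lambda>y. \<bar>u y\<bar>) x * \<bar>v x\<bar>)"
    proof (rule Bochner_Integration.integrable_bound)
      let ?B = "2 * wmax * (\<integral>y. \<bar>u y\<bar> \<partial>M)"
      show "integrable M (\<lambda>x. ?B * v x)" using v by simp
      show "(\<lambda>x. K (\<lambda>y. \<bar>u y\<bar>) x * \<bar>v x\<bar>) \<in> borel_measurable M" using K_measurable u v by simp
      have "\<bar>K (\<lambda>y. \<bar>u y\<bar>) x\<bar> * \<bar>v x\<bar> \<le> \<bar>?B\<bar> * \<bar>v x\<bar>" for x
        using K_abs_le[of "\<lambda>y. \<bar>u y\<bar>" x] u by (intro mult_right_mono) auto
      then show "AE x in M. norm (K (\<lambda>y. \<bar>u y\<bar>) x * \<bar>v x\<bar>) \<le> norm (?B * v x)"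
        by (simp add: abs_mult)
    qed
    then show "integrable M (\<lambda>x. \<integral>y. norm (case (x, y) of (x, y) \<Rightarrow> kern x y * u y * v x) \<partial>M)"
      using kern_nonneg by (simp add: abs_mult K_def)
    show "AE x in M. integrable M (\<lambda>y. case (x, y) of (x, y) \<Rightarrow> kern x y * u y * v x)"
      using kern_integrable[OF u] by simp
  qed
  have "(\<integral>x. K u x * v x \<partial>M) = (\<integral>x. \<integral>y. kern x y * u y * v x \<partial>M \<partial>M)" by (simp add: K_def)
  also have "\<dots> = (\<integral>y. \<integral>x. kern x y * u y * v x \<partial>M \<partial>M)"
    by (rule P.Fubini_integral[symmetric, OF int])
  also have "\<dots> = (\<integral>y. u y * K v y \<partial>M)"
  proof (rule Bochner_Integration.integral_cong[OF refl])
    fix y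
    have "(\<integral>x. kern x y * u y * v x \<partial>M) = (\<integral>x. u y * (kern y x * v x) \<partial>M)"
      by (simp add: kern_commute[of _ y] mult_ac)
    then show "(\<integral>x. kern x y * u y * v x \<partial>M) = u y * K v y" by (simp add: K_def)
  qed
  finally show ?thesis .
qed

text \<open>Separating the two weights expresses \<open>K f x\<close> through integrals of the fixed
  functions \<open>f\<close> and \<open>W f\<close> over the open ball, the only quantities that
  \<open>weakly_convergent_subsequence\<close> controls.\<close>

lemma K_split:
  assumes "f \<in> L2 M"
  shows "K f x = W x * (LINT y:ball x r|M. f y) + (LINT y:ball x r|M. W y * f y)"
proof -
  have Wf: "(\<lambda>y. W y * f y) \<in> L2 M"
    using W_pos W_le by (intro L2_mult_bounded(1)[OF assms, where B = wmax]) (auto simp: less_imp_le)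
  have i: "integrable M (\<lambda>y. indicator (ball x r) y * g y)" if "g \<in> L2 M" for g
    using integrable_mult_indicator[OF _ L2_integrable[OF that], of "ball x r"] by simp
  have "K f x = (\<integral>y. W x * (indicator (ball x r) y * f y) + indicator (ball x r) y * (W y * f y) \<partial>M)"
    unfolding K_def by (intro Bochner_Integration.integral_cong) (auto simp: kern_def algebra_simps)
  then show ?thesis using i[OF assms] i[OF Wf] by (simp add: set_lebesgue_integral_def)
qed

text \<open>Two successive extractions, first for \<open>F\<close> and then for \<open>W F\<close>,
  which is bounded in norm by \<open>wmax\<close>; convergence for \<open>F\<close> survives the
  second one.\<close>

lemma K_pointwise_compact:
  assumes F: "\<And>j. F j \<in> L2 M" and F1: "\<And>j. L2_norm_sq M (F j) \<le> 1"
  shows "\<exists>s. strict_mono (s :: nat \<Rightarrow> nat) \<and> (\<forall>x\<in>space M. convergent (\<lambda>j. K (F (s j)) x))"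
proof -
  have W_abs: "\<bar>W x\<bar> \<le> wmax" for x using W_pos[of x] W_le[of x] by simp
  obtain s1 where s1: "strict_mono (s1 :: nat \<Rightarrow> nat)"
    and c1: "\<And>U. open U \<Longrightarrow> convergent (\<lambda>j. LINT y:U|M. F (s1 j) y)"
    using weakly_convergent_subsequence[of F 1] F F1 by blast
  have WF: "(\<lambda>y. W y * F (s1 j) y) \<in> L2 M" for j
    using W_abs by (intro L2_mult_bounded(1)[OF F]) auto
  have "L2_norm_sq M (\<lambda>y. W y * F (s1 j) y) \<le> wmax\<^sup>2" for j
  proof -
    have "L2_norm_sq M (\<lambda>y. W y * F (s1 j) y) \<le> wmax\<^sup>2 * L2_norm_sq M (F (s1 j))"
      using W_abs by (intro L2_mult_bounded(2)[OF F]) auto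
    also have "\<dots> \<le> wmax\<^sup>2 * 1" by (intro mult_left_mono F1) auto
    finally show ?thesis by simp
  qed
  from weakly_convergent_subsequence[of "\<lambda>j y. W y * F (s1 j) y", OF WF this]
  obtain s2 where s2: "strict_mono (s2 :: nat \<Rightarrow> nat)"
    and c2: "\<And>U. open U \<Longrightarrow> convergent (\<lambda>j. LINT y:U|M. W y * F (s1 (s2 j)) y)" by blast
  have "convergent (\<lambda>j. K (F ((s1 \<circ> s2) j)) x)" for x
  proof -
    have "convergent (\<lambda>j. LINT y:ball x r|M. F (s1 (s2 j)) y)"
      using convergent_subseq_convergent[OF c1 s2, of "ball x r"] by (simp add: o_def)
    then show ?thesis
      using c2[of "ball x r"] by (simp add: K_split[OF F] convergent_add convergent_mult convergent_const)
  qed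
  then show ?thesis using strict_mono_o[OF s1 s2] by blast
qed

lemma a_measurable: "a \<in> borel_measurable M"
  unfolding a_def by (rule K_measurable) simp

text \<open>The \<open>W x\<close> part of the kernel integrates to exactly 1 and the rest is
  nonnegative.\<close>

lemma a_ge_1: "1 \<le> a x"
proof -
  have "integrable M (\<lambda>y. indicator (ball x r) y * W x)"
    by (rule integrable_mult_left) (simp add: emeasure_eq_measure)
  then have "(\<integral>y. indicator (ball x r) y * W x \<partial>M) \<le> (\<integral>y. kern x y * 1 \<partial>M)"
    using W_pos by (intro integral_mono kern_integrable) (auto simp: kern_def indicator_def less_imp_le)
  moreover have "(\<integral>y. indicator (ball x r) y * W x \<partial>M) = 1"
    using vol_pos[OF r_pos, of x] by (simp add: W_def)
  ultimately show ?thesis by (simp add: a_def K_def)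
qed

lemma a_le: "a x \<le> 2 * wmax * measure M UNIV"
  using K_abs_le[of "\<lambda>_. 1" x] by (simp add: a_def)

text \<open>The inner integral of the energy, without the factor
  \<open>1 / r\<^sup>2\<close>.\<close>

definition gap :: "('a \<Rightarrow> real) \<Rightarrow> 'a \<Rightarrow> real" where
  "gap f x = (\<integral>y. kern x y * (f x - f y)\<^sup>2 \<partial>M)"

lemma gap_integrable_inner:
  assumes f: "f \<in> L2 M"
  shows "integrable M (\<lambda>y. kern x y * (f x - f y)\<^sup>2)"
proof (rule kern_integrable)
  show "integrable M (\<lambda>y. (f x - f y)\<^sup>2)"
    unfolding power2_diff
    using L2_integrable[OF f] L2_integrable_square[OF f] by simp
qed

lemma gap_eq:
  assumes f: "f \<in> L2 M"
  shows "gap f x = a x * (f x)\<^sup>2 - 2 * (K f x * f x) + K (\<lambda>y. (f y)\<^sup>2) x"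
proof -
  note i = kern_integrable[of "\<lambda>_. 1" x, simplified] kern_integrable[OF L2_integrable[OF f], of x]
    kern_integrable[OF L2_integrable_square[OF f], of x]
  have "gap f x = (\<integral>y. (f x)\<^sup>2 * kern x y - 2 * f x * (kern x y * f y) + kern x y * (f y)\<^sup>2 \<partial>M)"
    unfolding gap_def
    by (intro Bochner_Integration.integral_cong) (auto simp: power2_eq_square algebra_simps)
  also have "\<dots> = (f x)\<^sup>2 * a x - 2 * f x * K f x + K (\<lambda>y. (f y)\<^sup>2) x"
    using i by (simp add: a_def K_def)
  finally show ?thesis by (simp add: mult_ac)
qed

lemma gap_nonneg: "0 \<le> gap f x"
  unfolding gap_def by (intro Bochner_Integration.integral_nonneg) (simp add: kern_nonneg)

lemma K_L2_abs_le:
  assumes "f \<in> L2 M"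
  shows "\<bar>K f x\<bar> \<le> (2 * wmax * sqrt (measure M UNIV)) * sqrt (L2_norm_sq M f)"
proof -
  have "\<bar>K f x\<bar> \<le> 2 * wmax * (\<integral>y. \<bar>f y\<bar> \<partial>M)" by (rule K_abs_le[OF L2_integrable[OF assms]])
  also have "\<dots> \<le> 2 * wmax * (sqrt (measure M UNIV) * sqrt (L2_norm_sq M f))"
    using L2_integral_abs_le[OF assms] wmax_pos by (intro mult_left_mono) auto
  finally show ?thesis by (simp add: mult.assoc)
qed

text \<open>Expanding the square gives \<open>a f^2 - 2 f K f + K (f^2)\<close>. By symmetry the
  last term integrates like \<open>a f^2\<close>, since \<open>a = K 1\<close>.\<close>

lemma gap_integral:
  assumes f: "f \<in> L2 M"
  shows "integrable M (gap f)"
    and "(\<integral>x. gap f x \<partial>M) = 2 * L2_inner M (\<lambda>x. a x * f x - K f x) f"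
proof -
  have abs_a: "\<bar>a x\<bar> \<le> 2 * wmax * measure M UNIV" for x using a_ge_1[of x] a_le[of x] by simp
  have af: "(\<lambda>x. a x * f x) \<in> L2 M" using L2_mult_bounded(1)[OF f a_measurable abs_a] .
  have Kf: "K f \<in> L2 M" using L2_bounded[OF K_measurable[OF L2_measurable[OF f]] K_L2_abs_le[OF f]] .
  have i1: "integrable M (\<lambda>x. a x * (f x)\<^sup>2)"
    using L2_integrable_mult[OF af f] by (simp add: power2_eq_square mult.assoc)
  have i2: "integrable M (\<lambda>x. K f x * f x)" by (rule L2_integrable_mult[OF Kf f])
  have i3: "integrable M (K (\<lambda>y. (f y)\<^sup>2))" by (rule K_integrable[OF L2_integrable_square[OF f]])
  have eq: "gap f = (\<lambda>x. a x * (f x)\<^sup>2 - 2 * (K f x * f x) + K (\<lambda>y. (f y)\<^sup>2) x)"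
    using gap_eq[OF f] by blast
  show "integrable M (gap f)" unfolding eq using i1 i2 i3 by simp
  have "(\<integral>x. K (\<lambda>y. (f y)\<^sup>2) x \<partial>M) = (\<integral>x. a x * (f x)\<^sup>2 \<partial>M)"
    using K_symmetric[OF L2_integrable_square[OF f], of "\<lambda>_. 1"] by (simp add: a_def mult.commute)
  then have "(\<integral>x. gap f x \<partial>M) = 2 * ((\<integral>x. a x * (f x)\<^sup>2 \<partial>M) - (\<integral>x. K f x * f x \<partial>M))"
    unfolding eq using i1 i2 i3 by simp
  also have "(\<integral>x. a x * (f x)\<^sup>2 \<partial>M) - (\<integral>x. K f x * f x \<partial>M) = L2_inner M (\<lambda>x. a x * f x - K f x) f"
    unfolding L2_inner_diff_left[OF af Kf f] by (simp add: L2_inner_def power2_eq_square mult.assoc)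
  finally show "(\<integral>x. gap f x \<partial>M) = 2 * L2_inner M (\<lambda>x. a x * f x - K f x) f" .
qed

sublocale op: compactly_perturbed_multiplication M a K "2 * wmax * measure M UNIV"
  "2 * wmax * sqrt (measure M UNIV)"
proof
  fix f g :: "'a \<Rightarrow> real" and x t
  assume f: "f \<in> L2 M"
  note i = kern_integrable[OF L2_integrable[OF f], of x]
  show "K f \<in> borel_measurable M" using f by (intro K_measurable L2_measurable)
  show "K (\<lambda>x. t * f x) x = t * K f x" by (simp add: K_def mult.left_commute)
  show "\<bar>K f x\<bar> \<le> 2 * wmax * sqrt (measure M UNIV) * sqrt (L2_norm_sq M f)" by (rule K_L2_abs_le[OF f])
  show "0 \<le> L2_inner M (\<lambda>x. a x * f x - K f x) f"
    using gap_integral(2)[OF f] Bochner_Integration.integral_nonneg[of M "gap f"] gap_nonneg by simp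
  assume g: "g \<in> L2 M"
  show "K (\<lambda>x. f x + g x) x = K f x + K g x"
    using i kern_integrable[OF L2_integrable[OF g], of x] by (simp add: K_def distrib_left)
  show "L2_inner M (K f) g = L2_inner M f (K g)"
    unfolding L2_inner_def by (rule K_symmetric[OF L2_integrable[OF f] L2_integrable[OF g]])
qed (use a_measurable a_ge_1 a_le K_pointwise_compact in auto)

lemma gap_integral_form: "f \<in> L2 M \<Longrightarrow> (\<integral>x. gap f x \<partial>M) = 2 * op.form f"
  using gap_integral(2)[of f] by (simp add: op.form_def op.T_def[abs_def])

text \<open>Distributing \<open>1/V(x,r)\<close> over \<open>1 + V(x,r)/V(y,r)\<close> produces the
  symmetric weight \<open>W x + W y\<close>.\<close>

lemma sym_amv_laplace_eq:
  assumes f: "f \<in> L2 M"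
  shows "- sym_amv_laplace M r f x = op.T f x / (2 * r\<^sup>2)"
proof -
  have V: "vol M x r \<noteq> 0" using vol_pos[OF r_pos, of x] by simp
  note i = kern_integrable[of "\<lambda>_. 1" x, simplified] kern_integrable[OF L2_integrable[OF f], of x]
  have "(1 / vol M x r) * (LINT y:ball x r|M. (1 + vol M x r / vol M y r) * (f y - f x)) =
      (\<integral>y. (1 / vol M x r) * (indicator (ball x r) y * ((1 + vol M x r / vol M y r) * (f y - f x))) \<partial>M)"
    by (simp add: set_lebesgue_integral_def)
  also have "\<dots> = (\<integral>y. kern x y * f y - f x * kern x y \<partial>M)"
  proof (rule Bochner_Integration.integral_cong[OF refl])
    fix y
    have "vol M y r \<noteq> 0" using vol_pos[OF r_pos, of y] by simp
    then have "1 / vol M x r * ((1 + vol M x r / vol M y r) * (f y - f x)) = (W x + W y) * (f y - f x)"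
      using V by (simp add: W_def divide_simps)
    then show "1 / vol M x r * (indicator (ball x r) y * ((1 + vol M x r / vol M y r) * (f y - f x)))
        = kern x y * f y - f x * kern x y"
      by (subst mult.left_commute) (simp only: kern_def, simp add: algebra_simps)
  qed
  also have "\<dots> = K f x - f x * a x" using i by (simp add: a_def K_def)
  also have "\<dots> = - op.T f x" by (simp add: op.T_def)
  finally have "(1 / vol M x r) * (LINT y:ball x r|M. (1 + vol M x r / vol M y r) * (f y - f x)) = - op.T f x" .
  then show ?thesis unfolding sym_amv_laplace_def mult.assoc by (simp only:) simp
qed

text \<open>The prefactor \<open>1/4\<close> meets the 2 of \<open>gap_integral_form\<close>,
  leaving the same \<open>1 / (2 * r\<^sup>2)\<close> as for the operator.\<close>

lemma sym_amv_energy_eq: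
  assumes f: "f \<in> L2 M"
  shows "sym_amv_energy M r f = ennreal (op.form f / (2 * r\<^sup>2))"
proof -
  have "(\<integral>\<^sup>+y. ennreal (indicator (ball x r) y * (1 / vol M x r + 1 / vol M y r) * ((f x - f y) / r)\<^sup>2) \<partial>M)
      = ennreal (gap f x / r\<^sup>2)" for x
  proof -
    have "(\<integral>\<^sup>+y. ennreal (indicator (ball x r) y * (1 / vol M x r + 1 / vol M y r) * ((f x - f y) / r)\<^sup>2) \<partial>M)
      = (\<integral>\<^sup>+y. ennreal (kern x y * (f x - f y)\<^sup>2 / r\<^sup>2) \<partial>M)"
      by (simp add: kern_def W_def power_divide)
    also have "\<dots> = ennreal (\<integral>y. kern x y * (f x - f y)\<^sup>2 / r\<^sup>2 \<partial>M)"
      using gap_integrable_inner[OF f] kern_nonneg by (intro nn_integral_eq_integral) auto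
    finally show ?thesis by (simp add: gap_def)
  qed
  then have "sym_amv_energy M r f = ennreal (1 / 4) * (\<integral>\<^sup>+x. ennreal (gap f x / r\<^sup>2) \<partial>M)"
    by (simp add: sym_amv_energy_def)
  also have "(\<integral>\<^sup>+x. ennreal (gap f x / r\<^sup>2) \<partial>M) = ennreal (\<integral>x. gap f x / r\<^sup>2 \<partial>M)"
    using gap_integral(1)[OF f] gap_nonneg by (intro nn_integral_eq_integral) auto
  also have "ennreal (1 / 4) * \<dots> = ennreal (op.form f / (2 * r\<^sup>2))"
    using op.form_nonneg[OF f] by (simp add: gap_integral_form[OF f] ennreal_mult''[symmetric])
  finally show ?thesis .
qed

end

section \<open>Test functions and connectedness\<close>

context compact_mm_space
begin

text \<open>Full support: a null set contains no ball.\<close>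

lemma AE_ball_witness:
  assumes "AE y in M. P y" "0 < e"
  obtains y where "dist p y < e" "P y"
proof -
  have "\<exists>y. dist p y < e \<and> P y"
  proof (rule ccontr)
    assume "\<not> (\<exists>y. dist p y < e \<and> P y)"
    then have "AE y in M. y \<notin> ball p e" using assms(1) by (auto elim!: eventually_mono)
    then have "ball p e \<in> null_sets M" by (subst AE_iff_null_sets) auto
    then show False using vol_pos[OF assms(2), of p] by (simp add: null_sets_def measure_def)
  qed
  then show ?thesis using that by blast
qed

text \<open>The points near which \<open>f\<close> takes a fixed value almost everywhere form an
  open and closed set, because overlapping neighbourhoods share a set of positive measure.\<close>

lemma locally_constant_AE_imp_constant_AE:
  fixes f :: "'a \<Rightarrow> real"
  assumes conn: "connected (UNIV :: 'a set)" and r: "0 < r"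
    and ae: "AE x in M. AE y in M. dist x y < r \<longrightarrow> f y = f x"
  shows "\<exists>c. AE x in M. f x = c"
proof -
  define G where "G = {x. AE y in M. dist x y < r \<longrightarrow> f y = f x}"
  have G: "AE x in M. x \<in> G" using ae by (simp add: G_def)
  obtain x0 where x0: "x0 \<in> G" using AE_ball_witness[OF G zero_less_one] by blast
  \<comment> \<open>Every point is tested through a neighbourhood, since \<open>G\<close> has full
    measure but need not be open or closed.\<close>
  define O' where "O' = {p. \<exists>s>0. AE y in M. dist p y < s \<longrightarrow> f y = f x0}"
  have "open O'"
    unfolding open_dist
  proof
    fix p assume "p \<in> O'"
    then obtain s where s: "0 < s" "AE y in M. dist p y < s \<longrightarrow> f y = f x0" by (auto simp: O'_def)
    have "q \<in> O'" if q: "dist q p < s / 2" for q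
    proof -
      have "AE y in M. dist q y < s / 2 \<longrightarrow> f y = f x0"
        using s(2)
      proof eventually_elim
        case (elim y)
        then show ?case using dist_triangle[of p y q] q by (auto simp: dist_commute)
      qed
      then show ?thesis using s(1) by (auto simp: O'_def intro!: exI[of _ "s / 2"])
    qed
    then show "\<exists>e>0. \<forall>y. dist y p < e \<longrightarrow> y \<in> O'" using s(1) by (intro exI[of _ "s / 2"]) auto
  qed
  moreover have "open (- O')"
    unfolding open_dist
  proof
    fix p assume p: "p \<in> - O'"
    \<comment> \<open>The point \<open>p\<close> may lie outside \<open>G\<close>; a nearby
      \<open>x\<close> in \<open>G\<close> still controls \<open>f\<close> on the ball of radius
      \<open>r / 2\<close> around \<open>p\<close>.\<close>
    obtain x where x: "dist p x < r / 2" "x \<in> G" using AE_ball_witness[OF G, of "r / 2"] r by auto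
    have near: "AE y in M. dist p y < r / 2 \<longrightarrow> f y = f x"
      using x(2)[unfolded G_def mem_Collect_eq]
    proof eventually_elim
      case (elim y)
      then show ?case using dist_triangle[of x y p] x(1) by (auto simp: dist_commute)
    qed
    then have ne: "f x \<noteq> f x0" using p r by (auto simp: O'_def intro: half_gt_zero)
    have "q \<notin> O'" if q: "dist q p < r / 2" for q
    proof
      assume "q \<in> O'"
      then obtain s where s: "0 < s" "AE y in M. dist q y < s \<longrightarrow> f y = f x0" by (auto simp: O'_def)
      \<comment> \<open>With this radius the ball around \<open>q\<close> lies in both
        neighbourhoods, where the two constants would have to agree.\<close>
      define e where "e = min s (r / 2 - dist q p)"
      have "0 < e" using s q by (simp add: e_def)
      moreover have "AE y in M. (dist p y < r / 2 \<longrightarrow> f y = f x) \<and> (dist q y < s \<longrightarrow> f y = f x0)"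
        using near s(2) by eventually_elim simp
      ultimately obtain y where y: "dist q y < e" "dist p y < r / 2 \<longrightarrow> f y = f x" "dist q y < s \<longrightarrow> f y = f x0"
        using AE_ball_witness[of "\<lambda>y. (dist p y < r / 2 \<longrightarrow> f y = f x) \<and> (dist q y < s \<longrightarrow> f y = f x0)" e q] by blast
      have "dist p y < r / 2" using y(1) dist_triangle[of p y q] by (simp add: e_def dist_commute)
      then show False using y ne by (simp add: e_def)
    qed
    then show "\<exists>e>0. \<forall>y. dist y p < e \<longrightarrow> y \<in> - O'" using r by (intro exI[of _ "r / 2"]) auto
  qed
  moreover have "x0 \<in> O'" using x0 r by (auto simp: O'_def G_def)
  ultimately have "O' = UNIV"
    using connectedD[OF conn, of O' "- O'"] by auto
  then have "\<forall>p. \<exists>s>0. AE y in M. dist p y < s \<longrightarrow> f y = f x0" by (auto simp: O'_def)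
  then obtain s where s: "\<And>p. 0 < s p" "\<And>p. AE y in M. dist p y < s p \<longrightarrow> f y = f x0" by metis
  have "UNIV \<subseteq> (\<Union>p. ball p (s p))" using s(1) by (auto intro!: centre_in_ball[THEN iffD2])
  then obtain N where N: "finite N" "UNIV \<subseteq> (\<Union>p\<in>N. ball p (s p))"
    using compactE_image[OF compact_UNIV, of UNIV "\<lambda>p. ball p (s p)"] by (metis open_ball)
  have "AE y in M. \<forall>p\<in>N. dist p y < s p \<longrightarrow> f y = f x0"
    unfolding AE_finite_all[OF N(1)] using s(2) by blast
  then have "AE y in M. f y = f x0"
    by eventually_elim (use N(2) in \<open>force simp: subset_iff\<close>)
  then show ?thesis by blast
qed

text \<open>Tent functions whose radius is at most half the smallest distance between centres have
  disjoint supports, so squared norms add. The constant \<open>\<beta>\<close> depends on the points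
  only and not on any scale \<open>r\<close>.\<close>

lemma test_functions_exist:
  fixes p :: "nat \<Rightarrow> 'a"
  assumes p: "inj_on p {..<n}"
  shows "\<exists>b \<beta>. 0 < \<beta> \<and> (\<forall>i. b i \<in> L2 M) \<and> (\<forall>i x y. \<bar>b i x - b i y\<bar> \<le> dist x y) \<and>
    (\<forall>d. \<beta> * (\<Sum>i<n. (d i)\<^sup>2) \<le> L2_norm_sq M (\<lambda>x. \<Sum>i<n. d i * b i x))"
proof -
  \<comment> \<open>The extra 1 keeps the minimum meaningful when there are no two distinct indices;
    likewise for \<open>\<beta>\<close> below when \<open>n = 0\<close>.\<close>
  define S where "S = insert 1 ((\<lambda>(i, j). dist (p i) (p j)) ` {(i, j). i < n \<and> j < n \<and> i \<noteq> j})"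
  have "finite {(i, j). i < n \<and> j < n \<and> i \<noteq> j}"
    by (rule finite_subset[of _ "{..<n} \<times> {..<n}"]) auto
  then have finS: "finite S" by (simp add: S_def)
  have Spos: "0 < s" if "s \<in> S" for s
    using that p by (auto simp: S_def inj_on_def)
  define \<delta> where "\<delta> = Min S / 2"
  have \<delta>: "0 < \<delta>" using Spos finS Min_in[of S] by (auto simp: \<delta>_def S_def)
  have sep: "2 * \<delta> \<le> dist (p i) (p j)" if "i < n" "j < n" "i \<noteq> j" for i j
  proof -
    have "dist (p i) (p j) \<in> S" using that by (force simp: S_def)
    then show ?thesis using finS by (simp add: \<delta>_def)
  qed
  define b where "b i x = max 0 (\<delta> - dist x (p i))" for i x
  have b_meas: "b i \<in> borel_measurable M" for i
  proof -
    have "b i \<in> borel_measurable borel"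
      unfolding b_def[abs_def] by (intro borel_measurable_continuous_onI continuous_intros)
    then show ?thesis by (simp add: measurable_cong_sets[OF sets_M refl])
  qed
  have b_le: "\<bar>b i x\<bar> \<le> \<delta>" for i x using \<delta> by (simp add: b_def)
  have b_L2: "b i \<in> L2 M" for i using L2_bounded[OF b_meas b_le] .
  have b_lip: "\<bar>b i x - b i y\<bar> \<le> dist x y" for i x y
    using dist_triangle[of x "p i" y] dist_triangle[of y "p i" x] by (auto simp: b_def dist_commute max_def)
  have b_disj: "b i x * b j x = 0" if "i < n" "j < n" "i \<noteq> j" for i j x
    using sep[OF that] dist_triangle[of "p i" "p j" x] by (auto simp: b_def max_def dist_commute)
  define \<beta> where "\<beta> = Min (insert 1 ((\<lambda>i. L2_norm_sq M (b i)) ` {..<n}))"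
  have b_pos: "0 < L2_norm_sq M (b i)" for i
  proof -
    have "\<not> (AE x in M. b i x = 0)"
    proof
      assume "AE x in M. b i x = 0"
      from AE_ball_witness[OF this \<delta>, of "p i"] show False by (auto simp: b_def dist_commute)
    qed
    then have "L2_norm_sq M (b i) \<noteq> 0" by (simp add: L2_norm_sq_eq_0_iff[OF b_L2] L2_zero_def)
    then show ?thesis using L2_norm_sq_nonneg[of M "b i"] by linarith
  qed
  have "0 < \<beta>" unfolding \<beta>_def using b_pos by (subst Min_gr_iff) auto
  moreover have "\<beta> * (\<Sum>i<n. (d i)\<^sup>2) \<le> L2_norm_sq M (\<lambda>x. \<Sum>i<n. d i * b i x)" for d
  proof -
    have sq: "(\<Sum>i<n. d i * b i x)\<^sup>2 = (\<Sum>i<n. (d i)\<^sup>2 * (b i x)\<^sup>2)" for x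
    proof -
      have "(\<Sum>j<n. d i * b i x * (d j * b j x)) = (d i)\<^sup>2 * (b i x)\<^sup>2" if i: "i < n" for i
      proof -
        have "(\<Sum>j<n. d i * b i x * (d j * b j x)) = (\<Sum>j<n. if j = i then (d i)\<^sup>2 * (b i x)\<^sup>2 else 0)"
        proof (rule sum.cong[OF refl])
          fix j assume "j \<in> {..<n}"
          then show "d i * b i x * (d j * b j x) = (if j = i then (d i)\<^sup>2 * (b i x)\<^sup>2 else 0)"
            using b_disj[OF i, of j x] by (auto simp: power2_eq_square)
        qed
        then show ?thesis using i by simp
      qed
      then show ?thesis by (simp add: power2_eq_square[of "sum _ _"] sum_product)
    qed
    have "\<beta> * (\<Sum>i<n. (d i)\<^sup>2) \<le> (\<Sum>i<n. (d i)\<^sup>2 * L2_norm_sq M (b i))"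
      unfolding sum_distrib_left
      by (intro sum_mono) (auto simp: \<beta>_def mult.commute[of _ "(d _)\<^sup>2"] intro!: mult_left_mono)
    also have "\<dots> = L2_norm_sq M (\<lambda>x. \<Sum>i<n. d i * b i x)"
      unfolding L2_norm_sq_def sq using L2_integrable_square[OF b_L2]
      by (simp add: Bochner_Integration.integral_sum)
    finally show ?thesis .
  qed
  ultimately show ?thesis using b_L2 b_lip by blast
qed

end

section \<open>Energy bounds, eigensystems and min-max values at scale \<open>r\<close>\<close>

context amv_scale
begin

text \<open>The \<open>W x\<close> part contributes 1 pointwise; for the \<open>W y\<close> part,
  integrating first in \<open>x\<close> gives \<open>V(y,r) W(y) = 1\<close>. Unlike the pointwise
  bound \<open>a_le\<close>, the result does not involve \<open>r\<close>.\<close>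

lemma integral_a: "integrable M a" "(\<integral>x. a x \<partial>M) = 2 * measure M UNIV"
proof -
  interpret P: pair_sigma_finite M M ..
  interpret PF: finite_measure "M \<Otimes>\<^sub>M M"
    by (rule finite_measure_pair_measure) unfold_locales
  have meas: "(\<lambda>(x, y). indicator (ball x r) y * W y) \<in> borel_measurable (M \<Otimes>\<^sub>M M)"
  proof -
    have "(\<lambda>(x, y). indicator (ball x r) y * W y) =
        (\<lambda>p. indicator {p. dist (fst p) (snd p) < r} p * W (snd p))"
      by (auto simp: indicator_def)
    moreover have "(\<lambda>p. indicator {p. dist (fst p) (snd p) < r} p * W (snd p)) \<in> borel_measurable (M \<Otimes>\<^sub>M M)"
      using dist_less_sets[of r] by measurable
    ultimately show ?thesis by simp
  qed
  have int: "integrable (M \<Otimes>\<^sub>M M) (\<lambda>(x, y). indicator (ball x r) y * W y)"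
    using W_pos W_le wmax_pos
    by (intro PF.integrable_const_bound[OF _ meas, where B = wmax])
      (auto simp: indicator_def less_imp_le)
  have one: "(\<lambda>_. 1) \<in> L2 M" by (rule L2_bounded[of _ 1]) auto
  have eq: "a x = 1 + (\<integral>y. indicator (ball x r) y * W y \<partial>M)" for x
    using K_split[OF one, of x] vol_pos[OF r_pos, of x]
    by (simp add: a_def set_lebesgue_integral_def W_def)
  have "(\<integral>x. \<integral>y. indicator (ball x r) y * W y \<partial>M \<partial>M) = (\<integral>y. \<integral>x. indicator (ball x r) y * W y \<partial>M \<partial>M)"
    by (rule P.Fubini_integral[symmetric, OF int])
  also have "\<dots> = (\<integral>y. 1 \<partial>M)"
  proof (rule Bochner_Integration.integral_cong[OF refl])
    fix y
    have "(\<integral>x. indicator (ball x r) y * W y \<partial>M) = (\<integral>x. indicator (ball y r) x * W y \<partial>M)"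
      by (intro Bochner_Integration.integral_cong) (auto simp: indicator_def dist_commute)
    then show "(\<integral>x. indicator (ball x r) y * W y \<partial>M) = 1"
      using vol_pos[OF r_pos, of y] by (simp add: W_def)
  qed
  finally have I: "(\<integral>x. \<integral>y. indicator (ball x r) y * W y \<partial>M \<partial>M) = measure M UNIV" by simp
  have i: "integrable M (\<lambda>x. \<integral>y. indicator (ball x r) y * W y \<partial>M)"
    using P.integrable_fst'[OF int] by simp
  show "integrable M a" unfolding eq[abs_def] using i by simp
  show "(\<integral>x. a x \<partial>M) = 2 * measure M UNIV" unfolding eq using i I by simp
qed

text \<open>The kernel vanishes beyond distance \<open>r\<close>, where increments could exceed
  \<open>L * r\<close>; hence \<open>gap f\<close> is at most \<open>(L * r)^2 * a\<close>, and
  \<open>integral_a\<close> finishes.\<close>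

lemma form_lipschitz_le:
  assumes f: "f \<in> L2 M" and L: "\<And>x y. \<bar>f x - f y\<bar> \<le> L * dist x y" and "0 \<le> L"
  shows "op.form f \<le> L\<^sup>2 * r\<^sup>2 * measure M UNIV"
proof -
  have "gap f x \<le> L\<^sup>2 * r\<^sup>2 * a x" for x
  proof -
    have "kern x y * (f x - f y)\<^sup>2 \<le> L\<^sup>2 * r\<^sup>2 * kern x y" for y
    proof (cases "dist x y < r")
      case True
      have "\<bar>f x - f y\<bar> \<le> \<bar>L * r\<bar>"
        using L[of x y] mult_left_mono[of "dist x y" r L] True \<open>0 \<le> L\<close> by simp
      then have "(f x - f y)\<^sup>2 \<le> (L * r)\<^sup>2" by (simp only: abs_le_square_iff)
      then have "kern x y * (f x - f y)\<^sup>2 \<le> kern x y * (L * r)\<^sup>2"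
        by (rule mult_left_mono[OF _ kern_nonneg])
      then show ?thesis by (simp add: power_mult_distrib mult_ac)
    next
      case False
      then show ?thesis by (simp add: kern_def)
    qed
    then have "gap f x \<le> (\<integral>y. L\<^sup>2 * r\<^sup>2 * (kern x y * 1) \<partial>M)"
      unfolding gap_def using gap_integrable_inner[OF f] kern_integrable[of "\<lambda>_. 1" x]
      by (intro integral_mono) auto
    then show ?thesis by (simp add: a_def K_def)
  qed
  then have "(\<integral>x. gap f x \<partial>M) \<le> (\<integral>x. L\<^sup>2 * r\<^sup>2 * a x \<partial>M)"
    using gap_integral(1)[OF f] integral_a(1) by (intro integral_mono) auto
  then show ?thesis by (simp add: gap_integral_form[OF f] integral_a(2))
qed

lemma form_const: "op.form (\<lambda>x. c) = 0"
proof -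
  have "(\<lambda>_. c) \<in> L2 M" by (rule L2_bounded[of _ "\<bar>c\<bar>"]) auto
  then show ?thesis using gap_integral_form[of "\<lambda>_. c"] by (simp add: gap_def)
qed

lemma form_eq_0_imp_constant_AE:
  assumes "connected (UNIV :: 'a set)" and f: "f \<in> L2 M" and "op.form f = 0"
  shows "\<exists>c. AE x in M. f x = c"
proof (rule locally_constant_AE_imp_constant_AE[OF assms(1) r_pos])
  have "(\<integral>x. gap f x \<partial>M) = 0" using assms by (simp add: gap_integral_form)
  then have "AE x in M. gap f x = 0"
    using integral_nonneg_eq_0_iff_AE[OF gap_integral(1)[OF f]] gap_nonneg by simp
  then show "AE x in M. AE y in M. dist x y < r \<longrightarrow> f y = f x"
  proof eventually_elim
    case (elim x)
    then have "AE y in M. kern x y * (f x - f y)\<^sup>2 = 0"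
      using integral_nonneg_eq_0_iff_AE[OF gap_integrable_inner[OF f, of x]] kern_nonneg
      by (simp add: gap_def)
    then show ?case
    proof eventually_elim
      case (elim y)
      have "W x + W y \<noteq> 0" using W_pos[of x] W_pos[of y] by linarith
      then show ?case using elim by (auto simp: kern_def)
    qed
  qed
qed

text \<open>Constants have zero form and compete in the first minimisation, since
  \<open>orth 0\<close> imposes no orthogonality condition.\<close>

lemma eigensystem_first_zero:
  assumes E: "op.eigensystem n \<phi> l" and "0 < n"
  shows "l 0 = 0"
proof -
  have "(\<lambda>_. 1) \<in> L2 M" by (rule L2_bounded[of _ 1]) auto
  then have "l 0 * L2_norm_sq M (\<lambda>_. 1) \<le> 0"
    using op.eigensystem_min[OF E \<open>0 < n\<close>, of "\<lambda>_. 1"] by (simp add: op.orth_def form_const)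
  moreover have "L2_norm_sq M (\<lambda>_. 1) = measure M UNIV" by (simp add: L2_norm_sq_def)
  ultimately have "l 0 \<le> 0" using measure_UNIV_pos by (simp add: mult_le_0_iff)
  then show ?thesis using op.eigensystem_nonneg[OF E \<open>0 < n\<close>] by simp
qed

text \<open>Otherwise \<open>\<phi> 0\<close> and \<open>\<phi> 1\<close> would both be almost
  everywhere constant, which is incompatible with their being orthonormal.\<close>

lemma eigensystem_second_pos:
  assumes E: "op.eigensystem n \<phi> l" and n: "1 < n" and conn: "connected (UNIV :: 'a set)"
  shows "0 < l 1"
proof (rule ccontr)
  assume "\<not> 0 < l 1"
  then have "op.form (\<phi> 1) = 0" "op.form (\<phi> 0) = 0"
    using op.eigensystem_nonneg[OF E n] eigensystem_first_zero[OF E] op.eigensystem_form[OF E] n by auto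
  then obtain c0 c1 where c: "AE x in M. \<phi> 0 x = c0" "AE x in M. \<phi> 1 x = c1"
    using form_eq_0_imp_constant_AE[OF conn] op.eigensystem_L2[OF E] n by (meson less_trans zero_less_one)
  have const: "(\<lambda>_. c) \<in> L2 M" for c by (rule L2_bounded[of _ "\<bar>c\<bar>"]) auto
  have ip: "L2_inner M (\<lambda>_. u) (\<lambda>_. v) = u * v * measure M UNIV" for u v
    by (simp add: L2_inner_def)
  note L = op.eigensystem_L2[OF E]
  have "c0 * c1 * measure M UNIV = 0" "c0 * c0 * measure M UNIV = 1" "c1 * c1 * measure M UNIV = 1"
    using op.eigensystem_orthonormal[OF E, of 0 1] op.eigensystem_orthonormal[OF E, of 0 0]
      op.eigensystem_orthonormal[OF E, of 1 1] n
      L2_inner_cong_AE[OF L const L const c(1) c(2)] L2_inner_cong_AE[OF L const L const c(1) c(1)]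
      L2_inner_cong_AE[OF L const L const c(2) c(2)]
    by (auto simp: ip)
  then show False by auto
qed

text \<open>On nonnull functions the extended quotient is an ordinary real Rayleigh quotient, so the
  two halves of the min-max principle transfer after division by
  \<open>2 * r\<^sup>2\<close>.\<close>

lemma eigensystem_minmax:
  assumes E: "op.eigensystem n \<phi> l" and i: "i < n"
  shows "ennreal (l i / (2 * r\<^sup>2)) = sym_amv_minmax M i r"
proof -
  have quot: "sym_amv_energy M r f / ennreal (L2_norm_sq M f) =
      ennreal (op.form f / (2 * r\<^sup>2) / L2_norm_sq M f)" and pos: "0 < L2_norm_sq M f"
    if f: "f \<in> L2 M" "f \<notin> L2_zero M" for f
  proof -
    show "0 < L2_norm_sq M f"
      using f L2_norm_sq_eq_0_iff[OF f(1)] L2_norm_sq_nonneg[of M f] by linarith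
    then show "sym_amv_energy M r f / ennreal (L2_norm_sq M f) =
      ennreal (op.form f / (2 * r\<^sup>2) / L2_norm_sq M f)"
      using op.form_nonneg[OF f(1)] by (simp add: sym_amv_energy_eq[OF f(1)] divide_ennreal)
  qed
  show ?thesis
  proof (rule antisym)
    show "ennreal (l i / (2 * r\<^sup>2)) \<le> sym_amv_minmax M i r"
      unfolding sym_amv_minmax_def
    proof (rule INF_greatest)
      fix V assume "V \<in> {V. L2_subspace M V \<and> L2_has_dim M V (i + 1)}"
      then have V: "L2_subspace M V" "L2_has_dim M V (i + 1)" by auto
      obtain f where f: "f \<in> V - L2_zero M" and le: "l i * L2_norm_sq M f \<le> op.form f"
        using op.eigensystem_le_subspace[OF E i V] by blast
      have fL: "f \<in> L2 M" "f \<notin> L2_zero M" using f V(1) by (auto simp: L2_subspace_def)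
      have "l i / (2 * r\<^sup>2) \<le> op.form f / (2 * r\<^sup>2) / L2_norm_sq M f"
        using le pos[OF fL] r_pos by (simp add: field_simps)
      then have "ennreal (l i / (2 * r\<^sup>2)) \<le> sym_amv_energy M r f / ennreal (L2_norm_sq M f)"
        unfolding quot[OF fL] by (rule ennreal_leI)
      also have "\<dots> \<le> (SUP f\<in>V - L2_zero M. sym_amv_energy M r f / ennreal (L2_norm_sq M f))"
        by (rule SUP_upper[OF f])
      finally show "ennreal (l i / (2 * r\<^sup>2)) \<le> \<dots>" .
    qed
    obtain V where V: "L2_subspace M V" "L2_has_dim M V (i + 1)"
      "\<And>f. f \<in> V \<Longrightarrow> op.form f \<le> l i * L2_norm_sq M f"
      using op.eigensystem_span[OF E i] by blast
    show "sym_amv_minmax M i r \<le> ennreal (l i / (2 * r\<^sup>2))"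
      unfolding sym_amv_minmax_def
    proof (rule INF_lower2)
      show "V \<in> {V. L2_subspace M V \<and> L2_has_dim M V (i + 1)}" using V by simp
      show "(SUP f\<in>V - L2_zero M. sym_amv_energy M r f / ennreal (L2_norm_sq M f))
          \<le> ennreal (l i / (2 * r\<^sup>2))"
      proof (rule SUP_least)
        fix f assume f: "f \<in> V - L2_zero M"
        then have fL: "f \<in> L2 M" "f \<notin> L2_zero M" using V(1) by (auto simp: L2_subspace_def)
        have "op.form f / (2 * r\<^sup>2) / L2_norm_sq M f \<le> l i / (2 * r\<^sup>2)"
          using V(3)[of f] f pos[OF fL] r_pos by (simp add: field_simps)
        then show "sym_amv_energy M r f / ennreal (L2_norm_sq M f) \<le> ennreal (l i / (2 * r\<^sup>2))"
          unfolding quot[OF fL] by (rule ennreal_leI)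
      qed
    qed
  qed
qed

lemma eigensystem_eigenvalues:
  assumes E: "op.eigensystem n \<phi> l"
  shows "L2_eigenvalues M (\<lambda>f x. - sym_amv_laplace M r f x) n (\<lambda>i. l i / (2 * r\<^sup>2))"
  unfolding L2_eigenvalues_def
proof (intro exI[of _ \<phi>] conjI allI impI)
  show "L2_independent M n \<phi>" by (rule op.eigensystem_independent[OF E order_refl])
  fix i assume i: "i < n"
  note L = op.eigensystem_L2[OF E i]
  have "\<phi> i \<notin> L2_zero M"
    using op.eigensystem_orthonormal[OF E i i] L2_norm_sq_eq_0_iff[OF L] by (simp add: L2_norm_sq_eq_inner)
  then show "L2_eigenfunction M (\<lambda>f x. - sym_amv_laplace M r f x) (l i / (2 * r\<^sup>2)) (\<phi> i)"
    using L op.eigensystem_T[OF E i] by (simp add: L2_eigenfunction_def sym_amv_laplace_eq)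
qed

lemma eigensystem_exists_of_test_functions:
  assumes b: "\<And>i. b i \<in> L2 M" and lip: "\<And>i x y. \<bar>b i x - b i y\<bar> \<le> dist x y"
    and \<beta>: "0 < \<beta>" "\<And>d. \<beta> * (\<Sum>i<n. (d i)\<^sup>2) \<le> L2_norm_sq M (\<lambda>x. \<Sum>i<n. d i * b i x)"
    and small: "real n * r\<^sup>2 * measure M UNIV < \<beta>"
  shows "\<exists>\<phi> l. op.eigensystem n \<phi> l"
proof (rule op.eigensystem_exists)
  show "b i \<in> L2 M" for i by (rule b)
  have P: "(\<lambda>x. \<Sum>i<n. d i * b i x) \<in> L2 M" for d using b by (intro L2_sum L2_cmult)
  show "L2_independent M n b"
    unfolding L2_independent_def
  proof (intro allI impI)
    fix d i assume ae: "AE x in M. (\<Sum>i<n. d i * b i x) = 0" and i: "i < n"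
    have "L2_norm_sq M (\<lambda>x. \<Sum>i<n. d i * b i x) = 0"
      using ae P by (subst L2_norm_sq_eq_0_iff) (auto simp: L2_zero_def)
    then have "\<beta> * (\<Sum>i<n. (d i)\<^sup>2) \<le> 0" using \<beta>(2)[of d] by simp
    then have "(\<Sum>i<n. (d i)\<^sup>2) \<le> 0" using \<beta>(1) by (simp add: mult_le_0_iff)
    then have "(\<Sum>i<n. (d i)\<^sup>2) = 0" by (intro antisym sum_nonneg) auto
    then show "d i = 0" using i by (simp add: sum_nonneg_eq_0_iff)
  qed
  fix d assume nz: "(\<lambda>x. \<Sum>i<n. d i * b i x) \<notin> L2_zero M"
  have "\<exists>i<n. d i \<noteq> 0" using nz P[of d] by (auto simp: L2_zero_def)
  then have dpos: "0 < (\<Sum>i<n. (d i)\<^sup>2)" by (auto intro!: sum_pos2)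
  define L where "L = (\<Sum>i<n. \<bar>d i\<bar>)"
  have "\<bar>(\<Sum>i<n. d i * b i x) - (\<Sum>i<n. d i * b i y)\<bar> \<le> L * dist x y" for x y
  proof -
    have "\<bar>(\<Sum>i<n. d i * b i x) - (\<Sum>i<n. d i * b i y)\<bar> = \<bar>\<Sum>i<n. d i * (b i x - b i y)\<bar>"
      by (simp add: sum_subtractf right_diff_distrib)
    also have "\<dots> \<le> (\<Sum>i<n. \<bar>d i * (b i x - b i y)\<bar>)" by (rule sum_abs)
    also have "\<dots> \<le> (\<Sum>i<n. \<bar>d i\<bar> * dist x y)"
      using lip by (intro sum_mono) (simp add: abs_mult mult_left_mono)
    finally show ?thesis by (simp add: L_def sum_distrib_right)
  qed
  then have "op.form (\<lambda>x. \<Sum>i<n. d i * b i x) \<le> L\<^sup>2 * r\<^sup>2 * measure M UNIV"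
    by (rule form_lipschitz_le[OF P]) (simp add: L_def sum_nonneg)
  \<comment> \<open>Cauchy-Schwarz on the Lipschitz constant \<open>L\<close>, the sum of the
    \<open>|d i|\<close>; this is the source of the factor \<open>n\<close> in
    \<open>small\<close>.\<close>
  also have "\<dots> \<le> ((\<Sum>i<n. (d i)\<^sup>2) * real n) * r\<^sup>2 * measure M UNIV"
    using sum_squared_le_sum_of_squares[of "\<lambda>i. \<bar>d i\<bar>" "{..<n}"]
    by (intro mult_right_mono) (auto simp: L_def)
  also have "\<dots> = (\<Sum>i<n. (d i)\<^sup>2) * (real n * r\<^sup>2 * measure M UNIV)" by (simp add: mult_ac)
  also have "\<dots> < (\<Sum>i<n. (d i)\<^sup>2) * \<beta>" by (rule mult_strict_left_mono[OF small dpos])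
  also have "\<dots> \<le> L2_norm_sq M (\<lambda>x. \<Sum>i<n. d i * b i x)" using \<beta>(2)[of d] by (simp add: mult.commute)
  finally show "op.form (\<lambda>x. \<Sum>i<n. d i * b i x) < L2_norm_sq M (\<lambda>x. \<Sum>i<n. d i * b i x)" .
qed

end

text \<open>Strict positivity of \<open>l 1\<close> is tied to connectedness: if a compact space
  splits into two nonempty open pieces, then for \<open>r\<close> below their distance both
  indicators have zero energy. The cardinality condition makes room for \<open>k + 1\<close>
  independent functions, because on a finite space L2 has one dimension per point.\<close>

theorem theorem1:
  fixes M :: "'a::metric_space measure" and k :: nat
  assumes "metric_measure_space M"
    and "compact (UNIV :: 'a set)"
    and "uniformly_locally_doubling M"
    and "k \<ge> 2"
    and "infinite (UNIV :: 'a set) \<or> k + 1 \<le> card (UNIV :: 'a set)"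
  shows "\<exists>r\<^sub>k>0. \<forall>r\<in>{0<..<r\<^sub>k}. \<exists>l :: nat \<Rightarrow> real.
           L2_eigenvalues M (\<lambda>f x. - sym_amv_laplace M r f x) (k + 1) l \<and>
           0 = l 0 \<and>
           (connected (UNIV :: 'a set) \<longrightarrow> l 0 < l 1) \<and>
           (\<forall>i<k. l i \<le> l (i + 1)) \<and>
           (\<forall>i\<le>k. ennreal (l i) = sym_amv_minmax M i r)"
proof -
  interpret compact_mm_space M using assms(1,2) by unfold_locales
  obtain S :: "'a set" where S: "finite S" "card S = k + 1"
    using assms(5) infinite_arbitrarily_large[of "UNIV :: 'a set" "k + 1"]
      obtain_subset_with_card_n[of "k + 1" "UNIV :: 'a set"] by metis
  obtain p where "bij_betw p {0..<k + 1} S" using ex_bij_betw_nat_finite[OF S(1)] S(2) by auto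
  then have "inj_on p {..<k + 1}" by (simp add: bij_betw_def lessThan_atLeast0)
  from test_functions_exist[OF this]
  obtain b :: "nat \<Rightarrow> 'a \<Rightarrow> real" and \<beta> where b: "0 < \<beta>" "\<forall>i. b i \<in> L2 M"
    "\<forall>i x y. \<bar>b i x - b i y\<bar> \<le> dist x y"
    "\<forall>d. \<beta> * (\<Sum>i<k + 1. (d i)\<^sup>2) \<le> L2_norm_sq M (\<lambda>x. \<Sum>i<k + 1. d i * b i x)"
    by (elim exE conjE)
  \<comment> \<open>For positive \<open>r\<close>, the condition \<open>r < R\<close> is the
    smallness condition on \<open>n * r^2\<close> times the total mass, with
    \<open>n = k + 1\<close>.\<close>
  define R where "R = sqrt (\<beta> / (real (k + 1) * measure M UNIV))"
  have R: "0 < R" unfolding R_def using b(1) measure_UNIV_pos by simp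
  show ?thesis
  proof (intro exI[of _ R] conjI R ballI)
    fix r assume "r \<in> {0<..<R}"
    then have r: "0 < r" "r < R" by auto
    interpret amv_scale M r using r(1) by unfold_locales
    have "r\<^sup>2 < R\<^sup>2" using r by (intro power_strict_mono) auto
    also have "R\<^sup>2 = \<beta> / (real (k + 1) * measure M UNIV)"
      unfolding R_def using b(1) measure_UNIV_pos by (intro real_sqrt_pow2) simp
    finally have "r\<^sup>2 * (real (k + 1) * measure M UNIV) < \<beta>"
      using measure_UNIV_pos by (subst (asm) pos_less_divide_eq) auto
    then have small: "real (k + 1) * r\<^sup>2 * measure M UNIV < \<beta>" by (simp only: mult_ac)
    obtain \<phi> l where E: "op.eigensystem (k + 1) \<phi> l"
      using eigensystem_exists_of_test_functions[OF b(2,3)[rule_format] b(1) b(4)[rule_format] small] by blast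
    show "\<exists>l. L2_eigenvalues M (\<lambda>f x. - sym_amv_laplace M r f x) (k + 1) l \<and>
        0 = l 0 \<and> (connected (UNIV :: 'a set) \<longrightarrow> l 0 < l 1) \<and> (\<forall>i<k. l i \<le> l (i + 1)) \<and>
        (\<forall>i\<le>k. ennreal (l i) = sym_amv_minmax M i r)"
    proof (intro exI[of _ "\<lambda>i. l i / (2 * r\<^sup>2)"] conjI allI impI)
      show "L2_eigenvalues M (\<lambda>f x. - sym_amv_laplace M r f x) (k + 1) (\<lambda>i. l i / (2 * r\<^sup>2))"
        by (rule eigensystem_eigenvalues[OF E])
      have l0: "l 0 = 0" by (rule eigensystem_first_zero[OF E]) simp
      then show "0 = l 0 / (2 * r\<^sup>2)" by simp
      show "l 0 / (2 * r\<^sup>2) < l 1 / (2 * r\<^sup>2)" if "connected (UNIV :: 'a set)"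
        using eigensystem_second_pos[OF E _ that] assms(4) l0 r(1) by simp
      show "l i / (2 * r\<^sup>2) \<le> l (i + 1) / (2 * r\<^sup>2)" if "i < k" for i
        using that by (intro divide_right_mono op.eigensystem_mono[OF E]) auto
      show "ennreal (l i / (2 * r\<^sup>2)) = sym_amv_minmax M i r" if "i \<le> k" for i
        using that by (intro eigensystem_minmax[OF E]) simp
    qed
  qed
qed

end
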